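(* Let $K$ be a small category and $G$ a group acting on $K$. The following two assertions are equivalent for any $t\ge2$: ($1_t$) Condition (C$_t$): if $m_1,\dots,m_{t-1},m_a,m_b$ are morphisms of $K$ with $\partial^\bullet m_i=\partial_\bullet m_{i-1}$ for all $2\le i\le t-1$, $\partial^\bullet m_a=\partial^\bullet m_b=\partial_\bullet m_{t-1}$, and $Gm_a=Gm_b$, then there is some $g\in G$ such that $gm_a=m_b$ and $gm_i=m_i$ for $1\le i\le t-1$. ($2_t$) The canonical surjection $\lambda:\Delta(K)/G\to\Delta(K/G)$ is injective on $t$-skeleta. In particular, $\lambda$ is an isomorphism if and only if (C$_t$) is satisfied for all $t\ge2$.
   Context: For a morphism $m$, $\partial^\bullet m$ denotes its source and $\partial_\bullet m$ its target. A group $G$ (viewed as a one-object category) acts on $K$ via a functor $\mathcal{A}_K:G\to\mathbf{Cat}$ sending the object to $K$; $Gm$ is the orbit of a morphism $m$. The quotient $K/G$ is the colimit of $\mathcal{A}_K$ in $\mathbf{Cat}$. Explicitly: objects of $K/G$ are the $G$-orbits of objects of $K$; morphisms are the equivalence classes $[x]$ of morphisms $x$ of $K$ under the transitive closure of the relation "$x$ and $y$ have decompositions $x=x_1\circ\dots\circ x_s$, $y=y_1\circ\dots\circ y_s$ with $Gx_i=Gy_i$ for all $i$", with source, target and composition induced from $K$. $\Delta:\mathbf{Cat}\to\mathbf{SSet}$ is the nerve functor; $\Delta(K)/G$ is the colimit (quotient) in simplicial sets, whose $t$-simplices are the $G$-orbits of chains $(m_1,\dots,m_t)$ of composable morphisms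 of $K$ ($\partial_\bullet m_{i-1}=\partial^\bullet m_i$). The canonical map $\lambda$, given by the universal property of the colimit, sends the orbit $G(m_1,\dots,m_t)$ to $([m_1],\dots,[m_t])$; it is always surjective. *)

theory Defs
  imports "HOL-Algebra.Group_Action"
begin

section \<open>Small categories and functors\<close>

record ('o, 'm) cat_data =
  Obj :: "'o set"
  Mor :: "'m set"
  src :: "'m \<Rightarrow> 'o"
  tgt :: "'m \<Rightarrow> 'o"
  idm :: "'o \<Rightarrow> 'm"
  cmp :: "'m \<Rightarrow> 'm \<Rightarrow> 'm"

text \<open>\<open>cmp K n m\<close> is \<open>n\<close> after \<open>m\<close>; it is meaningful only if \<open>tgt K m = src K n\<close>.\<close>

locale category =
  fixes K :: "('o, 'm) cat_data"
  assumes src_Obj: "m \<in> Mor K \<Longrightarrow> src K m \<in> Obj K"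
    and tgt_Obj: "m \<in> Mor K \<Longrightarrow> tgt K m \<in> Obj K"
    and idm_Mor: "a \<in> Obj K \<Longrightarrow> idm K a \<in> Mor K"
    and src_idm: "a \<in> Obj K \<Longrightarrow> src K (idm K a) = a"
    and tgt_idm: "a \<in> Obj K \<Longrightarrow> tgt K (idm K a) = a"
    and cmp_Mor: "\<lbrakk>m \<in> Mor K; n \<in> Mor K; tgt K m = src K n\<rbrakk> \<Longrightarrow> cmp K n m \<in> Mor K"
    and src_cmp: "\<lbrakk>m \<in> Mor K; n \<in> Mor K; tgt K m = src K n\<rbrakk> \<Longrightarrow> src K (cmp K n m) = src K m"
    and tgt_cmp: "\<lbrakk>m \<in> Mor K; n \<in> Mor K; tgt K m = src K n\<rbrakk> \<Longrightarrow> tgt K (cmp K n m) = tgt K n"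
    and cmp_idm_right: "m \<in> Mor K \<Longrightarrow> cmp K m (idm K (src K m)) = m"
    and cmp_idm_left: "m \<in> Mor K \<Longrightarrow> cmp K (idm K (tgt K m)) m = m"
    and cmp_assoc: "\<lbrakk>l \<in> Mor K; m \<in> Mor K; n \<in> Mor K; tgt K l = src K m; tgt K m = src K n\<rbrakk>
      \<Longrightarrow> cmp K n (cmp K m l) = cmp K (cmp K n m) l"

locale cat_functor = source: category K + target: category L
  for K :: "('o, 'm) cat_data" and L :: "('p, 'n) cat_data" +
  fixes fo :: "'o \<Rightarrow> 'p" and fm :: "'m \<Rightarrow> 'n"
  assumes fo_Obj: "a \<in> Obj K \<Longrightarrow> fo a \<in> Obj L"
    and fm_Mor: "m \<in> Mor K \<Longrightarrow> fm m \<in> Mor L"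
    and src_fm: "m \<in> Mor K \<Longrightarrow> src L (fm m) = fo (src K m)"
    and tgt_fm: "m \<in> Mor K \<Longrightarrow> tgt L (fm m) = fo (tgt K m)"
    and fm_idm: "a \<in> Obj K \<Longrightarrow> fm (idm K a) = idm L (fo a)"
    and fm_cmp: "\<lbrakk>m \<in> Mor K; n \<in> Mor K; tgt K m = src K n\<rbrakk>
      \<Longrightarrow> fm (cmp K n m) = cmp L (fm n) (fm m)"

text \<open>
  A functor from the one-object category \<open>G\<close> to \<open>Cat\<close> with value \<open>K\<close>: a family of endofunctors
  \<open>(aO g, aM g)\<close> of \<open>K\<close> respecting the unit and the multiplication of \<open>G\<close>. The two
  \<open>group_action\<close> assumptions express the latter, and include that \<open>G\<close> is a group.
\<close>

locale cat_action = category K + on_Obj: group_action G "Obj K" aO + on_Mor: group_action G "Mor K" aM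
  for G :: "('g, 'z) monoid_scheme" and K :: "('o, 'm) cat_data"
    and aO :: "'g \<Rightarrow> 'o \<Rightarrow> 'o" and aM :: "'g \<Rightarrow> 'm \<Rightarrow> 'm" +
  assumes functorial: "g \<in> carrier G \<Longrightarrow> cat_functor K K (aO g) (aM g)"


section \<open>Chains of composable morphisms\<close>

text \<open>
  \<open>chain K a [m\<^sub>1, \<dots>, m\<^sub>t]\<close>: the \<open>m\<^sub>i\<close> are composable, \<open>m\<^sub>1\<close> being the first to be applied and
  having source \<open>a\<close>. The object \<open>a\<close> is what remains of an empty chain.
\<close>

fun chain :: "('o, 'm) cat_data \<Rightarrow> 'o \<Rightarrow> 'm list \<Rightarrow> bool" where
  "chain K a [] \<longleftrightarrow> a \<in> Obj K"
| "chain K a (m # ms) \<longleftrightarrow> m \<in> Mor K \<and> src K m = a \<and> chain K (tgt K m) ms"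

fun composite :: "('o, 'm) cat_data \<Rightarrow> 'o \<Rightarrow> 'm list \<Rightarrow> 'm" where
  "composite K a [] = idm K a"
| "composite K a (m # ms) = cmp K (composite K (tgt K m) ms) m"

fun vertex :: "('o, 'm) cat_data \<Rightarrow> 'o \<Rightarrow> 'm list \<Rightarrow> nat \<Rightarrow> 'o" where
  "vertex K a ms 0 = a"
| "vertex K a ms (Suc i) = tgt K (ms ! i)"


section \<open>The quotient category\<close>

text \<open>
  Decompositions are listed in order of application. They are nonempty: an empty one would
  identify all identity morphisms. Morphisms of \<open>K/G\<close> are classes of the transitive closure.
\<close>

definition quot_rel ::
  "('g, 'z) monoid_scheme \<Rightarrow> ('o, 'm) cat_data \<Rightarrow> ('g \<Rightarrow> 'm \<Rightarrow> 'm) \<Rightarrow> ('m \<times> 'm) set" where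
  "quot_rel G K aM = {(x, y). \<exists>a b xs ys. xs \<noteq> [] \<and> chain K a xs \<and> chain K b ys
     \<and> x = composite K a xs \<and> y = composite K b ys
     \<and> list_all2 (\<lambda>u v. orbit G aM u = orbit G aM v) xs ys}"

definition quot_class ::
  "('g, 'z) monoid_scheme \<Rightarrow> ('o, 'm) cat_data \<Rightarrow> ('g \<Rightarrow> 'm \<Rightarrow> 'm) \<Rightarrow> 'm \<Rightarrow> 'm set" where
  "quot_class G K aM x = {y. (x, y) \<in> (quot_rel G K aM)\<^sup>+}"

text \<open>
  The structure maps of \<open>K/G\<close> are induced from \<open>K\<close>: each of the sets below to which \<open>the_elem\<close> is
  applied has exactly one element, so that no choice of representatives is involved. In
  \<open>cmp\<close>, the representatives \<open>y\<close> of \<open>Y\<close> and \<open>x\<close> of \<open>X\<close> range over all composable ones.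
\<close>

definition quot_cat ::
  "('g, 'z) monoid_scheme \<Rightarrow> ('o, 'm) cat_data \<Rightarrow> ('g \<Rightarrow> 'o \<Rightarrow> 'o) \<Rightarrow> ('g \<Rightarrow> 'm \<Rightarrow> 'm)
    \<Rightarrow> ('o set, 'm set) cat_data" where
  "quot_cat G K aO aM =
    \<lparr> Obj = orbits G (Obj K) aO,
      Mor = quot_class G K aM ` Mor K,
      src = (\<lambda>X. the_elem ((\<lambda>x. orbit G aO (src K x)) ` X)),
      tgt = (\<lambda>X. the_elem ((\<lambda>x. orbit G aO (tgt K x)) ` X)),
      idm = (\<lambda>A. the_elem ((\<lambda>a. quot_class G K aM (idm K a)) ` A)),
      cmp = (\<lambda>Y X. the_elem {quot_class G K aM (cmp K y x) | y x.
               y \<in> Y \<and> x \<in> X \<and> tgt K x = src K y}) \<rparr>"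


section \<open>Simplicial sets\<close>

text \<open>Morphisms \<open>[m] \<rightarrow> [n]\<close> of the simplex category, as extensional functions on \<open>{..m}\<close>.\<close>

definition Delta_hom :: "nat \<Rightarrow> nat \<Rightarrow> (nat \<Rightarrow> nat) set" where
  "Delta_hom m n = {\<alpha> \<in> {..m} \<rightarrow>\<^sub>E {..n}. mono_on {..m} \<alpha>}"

text \<open>\<open>pull X m n \<alpha>\<close> is the map \<open>X\<^sub>n \<rightarrow> X\<^sub>m\<close> induced by \<open>\<alpha> : [m] \<rightarrow> [n]\<close>.\<close>

record 'a sset_data =
  simplices :: "nat \<Rightarrow> 'a set"
  pull :: "nat \<Rightarrow> nat \<Rightarrow> (nat \<Rightarrow> nat) \<Rightarrow> 'a \<Rightarrow> 'a"

locale simplicial_set =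
  fixes X :: "'a sset_data"
  assumes pull_simp: "\<lbrakk>\<alpha> \<in> Delta_hom m n; x \<in> simplices X n\<rbrakk> \<Longrightarrow> pull X m n \<alpha> x \<in> simplices X m"
    and pull_id: "x \<in> simplices X n \<Longrightarrow> pull X n n (\<lambda>i \<in> {..n}. i) x = x"
    and pull_compose: "\<lbrakk>\<beta> \<in> Delta_hom l m; \<alpha> \<in> Delta_hom m n; x \<in> simplices X n\<rbrakk>
      \<Longrightarrow> pull X l n (compose {..l} \<alpha> \<beta>) x = pull X l m \<beta> (pull X m n \<alpha> x)"

locale sset_map = source: simplicial_set X + target: simplicial_set Y
  for X :: "'a sset_data" and Y :: "'b sset_data" +
  fixes f :: "nat \<Rightarrow> 'a \<Rightarrow> 'b"
  assumes map_simp: "x \<in> simplices X n \<Longrightarrow> f n x \<in> simplices Y n"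
    and map_pull: "\<lbrakk>\<alpha> \<in> Delta_hom m n; x \<in> simplices X n\<rbrakk> \<Longrightarrow> f m (pull X m n \<alpha> x) = pull Y m n \<alpha> (f n x)"

definition sset_iso :: "'a sset_data \<Rightarrow> 'b sset_data \<Rightarrow> (nat \<Rightarrow> 'a \<Rightarrow> 'b) \<Rightarrow> bool" where
  "sset_iso X Y f \<longleftrightarrow> sset_map X Y f \<and>
    (\<exists>h. sset_map Y X h \<and> (\<forall>n. (\<forall>x \<in> simplices X n. h n (f n x) = x) \<and> (\<forall>y \<in> simplices Y n. f n (h n y) = y)))"

text \<open>
  The \<open>t\<close>-skeleton is the simplicial subset generated by the simplices of dimension at most \<open>t\<close>;
  in dimensions above \<open>t\<close> it consists of degenerate simplices.
\<close>

definition skel :: "nat \<Rightarrow> 'a sset_data \<Rightarrow> 'a sset_data" where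
  "skel t X = \<lparr> simplices = (\<lambda>n. {pull X n k \<alpha> x | k \<alpha> x. k \<le> t \<and> \<alpha> \<in> Delta_hom n k \<and> x \<in> simplices X k}),
                pull = pull X \<rparr>"

definition injective_on_skel :: "nat \<Rightarrow> 'a sset_data \<Rightarrow> (nat \<Rightarrow> 'a \<Rightarrow> 'b) \<Rightarrow> bool" where
  "injective_on_skel t X f \<longleftrightarrow> (\<forall>n. inj_on (f n) (simplices (skel t X) n))"

text \<open>Colimits of simplicial sets are formed dimensionwise: \<open>X/G\<close> consists of the orbits of simplices.\<close>

definition quot_sset ::
  "('g, 'z) monoid_scheme \<Rightarrow> 'a sset_data \<Rightarrow> (nat \<Rightarrow> 'g \<Rightarrow> 'a \<Rightarrow> 'a) \<Rightarrow> 'a set sset_data" where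
  "quot_sset G X \<rho> = \<lparr> simplices = (\<lambda>n. orbits G (simplices X n) (\<rho> n)),
                        pull = (\<lambda>m n \<alpha> S. pull X m n \<alpha> ` S) \<rparr>"


section \<open>The nerve and the canonical map\<close>

text \<open>
  An \<open>n\<close>-simplex of the nerve is a chain of \<open>n\<close> morphisms together with its initial object. For
  \<open>n \<ge> 1\<close> that object is redundant, for \<open>n = 0\<close> it is the simplex itself.
\<close>

definition nerve_pull ::
  "('o, 'm) cat_data \<Rightarrow> nat \<Rightarrow> (nat \<Rightarrow> nat) \<Rightarrow> 'o \<times> 'm list \<Rightarrow> 'o \<times> 'm list" where
  "nerve_pull K m \<alpha> = (\<lambda>(a, ms).
     (vertex K a ms (\<alpha> 0),
      map (\<lambda>i. composite K (vertex K a ms (\<alpha> i)) (take (\<alpha> (Suc i) - \<alpha> i) (drop (\<alpha> i) ms))) [0..<m]))"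

definition nerve :: "('o, 'm) cat_data \<Rightarrow> ('o \<times> 'm list) sset_data" where
  "nerve K = \<lparr> simplices = (\<lambda>n. {(a, ms). length ms = n \<and> chain K a ms}),
               pull = (\<lambda>m n. nerve_pull K m) \<rparr>"

definition nerve_map ::
  "('o \<Rightarrow> 'p) \<Rightarrow> ('m \<Rightarrow> 'n) \<Rightarrow> nat \<Rightarrow> 'o \<times> 'm list \<Rightarrow> 'p \<times> 'n list" where
  "nerve_map fo fm n = (\<lambda>(a, ms). (fo a, map fm ms))"

definition nerve_quot ::
  "('g, 'z) monoid_scheme \<Rightarrow> ('o, 'm) cat_data \<Rightarrow> ('g \<Rightarrow> 'o \<Rightarrow> 'o) \<Rightarrow> ('g \<Rightarrow> 'm \<Rightarrow> 'm)
    \<Rightarrow> ('o \<times> 'm list) set sset_data" where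
  "nerve_quot G K aO aM = quot_sset G (nerve K) (\<lambda>n g. nerve_map (aO g) (aM g) n)"

text \<open>
  The map induced on orbits by the nerve of the projection \<open>K \<rightarrow> K/G\<close>. That nerve is constant on
  orbits, so its image of an orbit is a singleton.
\<close>

definition canonical_map ::
  "('g, 'z) monoid_scheme \<Rightarrow> ('o, 'm) cat_data \<Rightarrow> ('g \<Rightarrow> 'o \<Rightarrow> 'o) \<Rightarrow> ('g \<Rightarrow> 'm \<Rightarrow> 'm)
    \<Rightarrow> nat \<Rightarrow> ('o \<times> 'm list) set \<Rightarrow> 'o set \<times> 'm set list" where
  "canonical_map G K aO aM n S = the_elem (nerve_map (orbit G aO) (quot_class G K aM) n ` S)"


section \<open>The lifting condition\<close>

definition condition_C ::
  "('g, 'z) monoid_scheme \<Rightarrow> ('o, 'm) cat_data \<Rightarrow> ('g \<Rightarrow> 'm \<Rightarrow> 'm) \<Rightarrow> nat \<Rightarrow> bool" where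
  "condition_C G K aM t \<longleftrightarrow>
    (\<forall>m ma mb.
      (\<forall>i \<in> {1..t - 1}. m i \<in> Mor K) \<and> ma \<in> Mor K \<and> mb \<in> Mor K
      \<and> (\<forall>i \<in> {2..t - 1}. src K (m i) = tgt K (m (i - 1)))
      \<and> src K ma = tgt K (m (t - 1)) \<and> src K mb = tgt K (m (t - 1))
      \<and> orbit G aM ma = orbit G aM mb
      \<longrightarrow> (\<exists>g \<in> carrier G. aM g ma = mb \<and> (\<forall>i \<in> {1..t - 1}. aM g (m i) = m i)))"

end

theory Submission
  imports Defs
begin

text \<open>
  Two simplices of the nerve with the same image in the nerve of \<open>K/G\<close> are matched entry by entry:
  once a group element carries an initial segment of one chain to the other, \<open>(C\<^sub>t)\<close> corrects the
  next entry without moving that segment. This needs the classes in \<open>K/G\<close> to be orbits, which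
  follows from \<open>(C\<^sub>2)\<close> in the same way. Identities are matched for free, so only the number of
  non-identity entries counts; in the \<open>t\<close>-skeleton it is at most \<open>t\<close> in every dimension.
  Conversely, \<open>(C\<^sub>t)\<close> is injectivity on two \<open>t\<close>-simplices that differ in the last entry only.
\<close>

section \<open>Chains and the nerve\<close>

text \<open>(C_t) prescribes exactly \<open>t - 1\<close> fixed morphisms, while the chains met in
  the proof have other lengths: simplices of the skeleton can be arbitrarily long, and comparing
  composites needs a single fixed morphism. Both gaps are closed by reshaping the chain with
  identities. Those occurring in it are dropped, and copies of \<open>idm K a\<close> at the initial
  object \<open>a\<close> are put in front until the length is right. As \<open>t \<ge> 2\<close>,
  the padded chain is nonempty, so the group element obtained fixes \<open>a\<close> and with it,
  step by step along the chain, the dropped identities. A second obstacle lies in \<open>K/G\<close>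
  itself: a step of the quotient relation moves the ends of a morphism within their orbits, so
  representatives of composable classes need not be composable. Well-definedness of composition
  rests on moving a neighbouring morphism along by a group element at every step.\<close>

text \<open>\<open>vertex\<close> is a single lookup, whereas \<open>chain\<close> and
  \<open>composite\<close> recurse along the list. This supplies the matching recursion; inductions
  delete \<open>vertex.simps(2)\<close>, which would otherwise unfold the left-hand side
  first.\<close>

lemma vertex_Cons_Suc: "vertex K a (m # ms) (Suc i) = vertex K (tgt K m) ms i"
  by (cases i) auto

lemma vertex_append:
  "vertex K a (xs @ ys) (length xs + i) = vertex K (vertex K a xs (length xs)) ys i"
  by (induction xs arbitrary: a) (simp_all add: vertex_Cons_Suc del: vertex.simps(2))

lemma vertex_append_le: "i \<le> length xs \<Longrightarrow> vertex K a (xs @ ys) i = vertex K a xs i"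
  by (cases i) (auto simp: nth_append)

lemma chain_Mor: "chain K a ms \<Longrightarrow> set ms \<subseteq> Mor K"
  by (induction ms arbitrary: a) auto

text \<open>A chain of length \<open>n\<close> is a functor from the ordered set \<open>[n]\<close>
  to \<open>K\<close>; this is its value on the arrow \<open>i \<le> j\<close>. Pulling back along
  \<alpha> becomes precomposition.\<close>

definition segment :: "('o, 'm) cat_data \<Rightarrow> 'o \<Rightarrow> 'm list \<Rightarrow> nat \<Rightarrow> nat \<Rightarrow> 'm" where
  "segment K a ms i j = composite K (vertex K a ms i) (take (j - i) (drop i ms))"

lemma nerve_pull_segment:
  "nerve_pull K m \<alpha> (a, ms) =
    (vertex K a ms (\<alpha> 0), map (\<lambda>i. segment K a ms (\<alpha> i) (\<alpha> (Suc i))) [0..<m])"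
  by (simp add: nerve_pull_def segment_def)

lemma Delta_hom_le: "\<alpha> \<in> Delta_hom m n \<Longrightarrow> i \<le> m \<Longrightarrow> \<alpha> i \<le> n"
  by (auto simp: Delta_hom_def)

lemma Delta_hom_mono: "\<alpha> \<in> Delta_hom m n \<Longrightarrow> i \<le> j \<Longrightarrow> j \<le> m \<Longrightarrow> \<alpha> i \<le> \<alpha> j"
  by (auto simp: Delta_hom_def mono_on_def)

lemma chain_nth_Mor: "chain K a ms \<Longrightarrow> i < length ms \<Longrightarrow> ms ! i \<in> Mor K"
  by (meson chain_Mor nth_mem subsetD)

lemma take_drop_map_upt:
  "i \<le> j \<Longrightarrow> j \<le> m \<Longrightarrow> take (j - i) (drop i (map f [0..<m])) = map f [i..<j]"
  by (simp add: drop_map take_map)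

context category
begin

lemma chain_Obj: "chain K a ms \<Longrightarrow> a \<in> Obj K"
  by (cases ms) (auto intro: src_Obj)

lemma chain_append:
  "chain K a (xs @ ys) \<longleftrightarrow> chain K a xs \<and> chain K (vertex K a xs (length xs)) ys"
proof (induction xs arbitrary: a)
  case Nil
  show ?case by (auto simp: chain_Obj)
next
  case (Cons x xs)
  then show ?case by (auto simp: vertex_Cons_Suc simp del: vertex.simps(2))
qed

lemma composite_singleton: "m \<in> Mor K \<Longrightarrow> composite K a [m] = m"
  by (simp add: cmp_idm_left)

lemma vertex_Obj: "chain K a ms \<Longrightarrow> i \<le> length ms \<Longrightarrow> vertex K a ms i \<in> Obj K"
  by (cases i) (auto simp: chain_Obj chain_nth_Mor intro!: tgt_Obj)

lemma composite_Mor: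
  assumes "chain K a ms"
  shows "composite K a ms \<in> Mor K \<and> src K (composite K a ms) = a
    \<and> tgt K (composite K a ms) = vertex K a ms (length ms)"
  using assms
proof (induction ms arbitrary: a)
  case Nil
  then show ?case by (simp add: idm_Mor src_idm tgt_idm)
next
  case (Cons m ms)
  then show ?case
    by (auto simp: vertex_Cons_Suc cmp_Mor src_cmp tgt_cmp simp del: vertex.simps(2))
qed

lemma composite_append:
  assumes "chain K a (xs @ ys)"
  shows "composite K a (xs @ ys)
    = cmp K (composite K (vertex K a xs (length xs)) ys) (composite K a xs)"
  using assms
proof (induction xs arbitrary: a)
  case Nil
  then show ?case
    using composite_Mor[of a ys] by simp (metis cmp_idm_right)
next
  case (Cons x xs)
  then have *: "chain K (tgt K x) xs" "chain K (vertex K (tgt K x) xs (length xs)) ys"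
    by (auto simp: chain_append)
  from Cons show ?case
    using composite_Mor[OF *(1)] composite_Mor[OF *(2)]
    by (auto simp: vertex_Cons_Suc simp del: vertex.simps(2) intro!: cmp_assoc[symmetric])
qed

lemma chain_segment:
  assumes "chain K a ms" "i \<le> j" "j \<le> length ms"
  shows "chain K (vertex K a ms i) (take (j - i) (drop i ms))"
    and "vertex K (vertex K a ms i) (take (j - i) (drop i ms)) (j - i) = vertex K a ms j"
proof -
  let ?p = "take i ms" and ?q = "take (j - i) (drop i ms)" and ?r = "drop j ms"
  have ms: "ms = ?p @ ?q @ ?r"
    using assms(2) by (metis append_assoc append_take_drop_id le_add_diff_inverse take_add)
  have len: "length ?p = i" "length ?q = j - i" using assms(2,3) by auto
  have vi: "vertex K a ?p i = vertex K a ms i"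
    using vertex_append_le[of i ?p K a "?q @ ?r"] ms len by simp
  show "chain K (vertex K a ms i) ?q"
    using assms(1) ms len vi chain_append by metis
  have "vertex K a ((?p @ ?q) @ ?r) j = vertex K a (?p @ ?q) (length ?p + (j - i))"
    using vertex_append_le[of j "?p @ ?q" K a ?r] len assms(2) by simp
  then show "vertex K (vertex K a ms i) ?q (j - i) = vertex K a ms j"
    unfolding vertex_append using ms len vi by simp
qed

lemma segment_Mor:
  assumes "chain K a ms" "i \<le> j" "j \<le> length ms"
  shows "segment K a ms i j \<in> Mor K" "src K (segment K a ms i j) = vertex K a ms i"
    "tgt K (segment K a ms i j) = vertex K a ms j"
  using composite_Mor[OF chain_segment(1)[OF assms]] chain_segment(2)[OF assms] assms
  by (auto simp: segment_def)

lemma segment_same: "segment K a ms i i = idm K (vertex K a ms i)"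
  by (simp add: segment_def)

lemma segment_compose:
  assumes "chain K a ms" "i \<le> j" "j \<le> k" "k \<le> length ms"
  shows "segment K a ms i k = cmp K (segment K a ms j k) (segment K a ms i j)"
proof -
  let ?p = "take (j - i) (drop i ms)" and ?q = "take (k - j) (drop j ms)"
  have "take (k - i) (drop i ms) = ?p @ ?q"
    using assms(2,3) take_add[of "j - i" "k - j" "drop i ms"] by (simp add: add.commute)
  moreover have "length ?p = j - i" using assms by simp
  moreover have "chain K (vertex K a ms i) (take (k - i) (drop i ms))"
    using chain_segment(1)[OF assms(1), of i k] assms by simp
  ultimately show ?thesis
    using composite_append[of "vertex K a ms i" ?p ?q] chain_segment(2)[OF assms(1,2)] assms
    by (simp add: segment_def)
qed

lemma segment_Suc: "chain K a ms \<Longrightarrow> i < length ms \<Longrightarrow> segment K a ms i (Suc i) = ms ! i"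
  using chain_Mor[of K a ms]
  by (auto simp: segment_def take_Suc hd_drop_conv_nth cmp_idm_left subset_iff)

lemma vertex_nerve_pull:
  assumes "chain K a ms" "\<alpha> \<in> Delta_hom m (length ms)" "i \<le> m"
  shows "vertex K (vertex K a ms (\<alpha> 0)) (map (\<lambda>i. segment K a ms (\<alpha> i) (\<alpha> (Suc i))) [0..<m]) i
    = vertex K a ms (\<alpha> i)"
  using assms by (cases i) (auto simp: segment_Mor Delta_hom_mono[OF assms(2)] Delta_hom_le[OF assms(2)])

text \<open>Consecutive segments telescope. The induction lowers \<open>i\<close> towards
  \<open>0\<close> because \<open>composite\<close> splits off the first entry.\<close>

lemma chain_segments:
  assumes "chain K a ms" "\<alpha> \<in> Delta_hom m (length ms)" "i \<le> j" "j \<le> m"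
  shows "chain K (vertex K a ms (\<alpha> i)) (map (\<lambda>i. segment K a ms (\<alpha> i) (\<alpha> (Suc i))) [i..<j])
    \<and> composite K (vertex K a ms (\<alpha> i)) (map (\<lambda>i. segment K a ms (\<alpha> i) (\<alpha> (Suc i))) [i..<j])
      = segment K a ms (\<alpha> i) (\<alpha> j)"
  using assms(3)
proof (induction i rule: inc_induct)
  case base
  then show ?case
    using assms by (simp add: segment_same vertex_Obj Delta_hom_le[OF assms(2)])
next
  case (step i)
  have le: "\<alpha> i \<le> \<alpha> (Suc i)" "\<alpha> (Suc i) \<le> \<alpha> j" "\<alpha> (Suc i) \<le> length ms" "\<alpha> j \<le> length ms"
    using step assms by (auto simp: Delta_hom_mono[OF assms(2)] Delta_hom_le[OF assms(2)])
  show ?case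
    using step le assms(1) by (simp add: upt_conv_Cons segment_Mor segment_compose[of a ms "\<alpha> i" "\<alpha> (Suc i)" "\<alpha> j"])
qed

text \<open>With chains read as functors, this is precomposition on arrows; evaluated at the values
  of a second map it gives \<open>pull_compose\<close> for the nerve.\<close>

lemma segment_nerve_pull:
  assumes "chain K a ms" "\<alpha> \<in> Delta_hom m (length ms)" "i \<le> j" "j \<le> m"
  shows "segment K (vertex K a ms (\<alpha> 0)) (map (\<lambda>i. segment K a ms (\<alpha> i) (\<alpha> (Suc i))) [0..<m]) i j
    = segment K a ms (\<alpha> i) (\<alpha> j)"
  unfolding segment_def[of K "vertex K a ms (\<alpha> 0)"]
  using vertex_nerve_pull[OF assms(1,2), of i] chain_segments[OF assms] assms(3,4)
  by (simp only: take_drop_map_upt)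

lemma simplicial_set_nerve: "simplicial_set (nerve K)"
proof
  fix \<alpha> m n and x :: "'o \<times> 'm list"
  assume \<alpha>: "\<alpha> \<in> Delta_hom m n" and x: "x \<in> simplices (nerve K) n"
  obtain a ms where [simp]: "x = (a, ms)" by force
  from x have *: "chain K a ms" "length ms = n" by (auto simp: nerve_def)
  with chain_segments[of a ms \<alpha> m 0 m] \<alpha>
  show "pull (nerve K) m n \<alpha> x \<in> simplices (nerve K) m"
    by (auto simp: nerve_def nerve_pull_segment)
next
  fix n and x :: "'o \<times> 'm list"
  assume x: "x \<in> simplices (nerve K) n"
  obtain a ms where [simp]: "x = (a, ms)" by force
  from x have *: "chain K a ms" "length ms = n" by (auto simp: nerve_def)
  then have "map (\<lambda>i. segment K a ms i (Suc i)) [0..<n] = ms"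
    by (intro nth_equalityI) (auto simp: segment_Suc)
  \<comment> \<open>The identity of \<open>[n]\<close> is restricted to \<open>{..n}\<close>, which
    contains both \<open>i\<close> and \<open>Suc i\<close> for \<open>i < n\<close>.\<close>
  moreover have "map (\<lambda>i. segment K a ms ((\<lambda>i \<in> {..n}. i) i) ((\<lambda>i \<in> {..n}. i) (Suc i))) [0..<n]
      = map (\<lambda>i. segment K a ms i (Suc i)) [0..<n]"
    by (intro map_cong) auto
  ultimately show "pull (nerve K) n n (\<lambda>i \<in> {..n}. i) x = x"
    by (simp add: nerve_def nerve_pull_segment)
next
  fix \<alpha> \<beta> l m n and x :: "'o \<times> 'm list"
  assume \<beta>: "\<beta> \<in> Delta_hom l m" and \<alpha>: "\<alpha> \<in> Delta_hom m n" and x: "x \<in> simplices (nerve K) n"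
  obtain a ms where [simp]: "x = (a, ms)" by force
  from x have *: "chain K a ms" "length ms = n" by (auto simp: nerve_def)
  have "map (\<lambda>i. segment K a ms (compose {..l} \<alpha> \<beta> i) (compose {..l} \<alpha> \<beta> (Suc i))) [0..<l]
      = map (\<lambda>i. segment K (vertex K a ms (\<alpha> 0))
          (map (\<lambda>i. segment K a ms (\<alpha> i) (\<alpha> (Suc i))) [0..<m]) (\<beta> i) (\<beta> (Suc i))) [0..<l]"
    using * \<beta> segment_nerve_pull[of a ms \<alpha> m] \<alpha>
    by (intro map_cong) (auto simp: compose_def Delta_hom_mono[OF \<beta>] Delta_hom_le[OF \<beta>])
  then show "pull (nerve K) l n (compose {..l} \<alpha> \<beta>) x
      = pull (nerve K) l m \<beta> (pull (nerve K) m n \<alpha> x)"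
    using * \<beta> vertex_nerve_pull[of a ms \<alpha> m "\<beta> 0"] \<alpha>
    by (simp add: nerve_def nerve_pull_segment compose_def Delta_hom_le[OF \<beta>])
qed

end

section \<open>Functoriality of the nerve\<close>

context cat_functor
begin

lemma chain_map: "chain K a ms \<Longrightarrow> chain L (fo a) (map fm ms)"
  by (induction ms arbitrary: a) (auto simp: fo_Obj fm_Mor src_fm tgt_fm)

lemma vertex_map:
  "chain K a ms \<Longrightarrow> i \<le> length ms \<Longrightarrow> vertex L (fo a) (map fm ms) i = fo (vertex K a ms i)"
  by (cases i) (auto simp: tgt_fm chain_nth_Mor)

lemma composite_map:
  "chain K a ms \<Longrightarrow> composite L (fo a) (map fm ms) = fm (composite K a ms)"
proof (induction ms arbitrary: a)
  case Nil
  then show ?case by (simp add: fm_idm)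
next
  case (Cons m ms)
  then show ?case
    using source.composite_Mor[of "tgt K m" ms] by (simp add: fm_cmp tgt_fm)
qed

lemma segment_map:
  assumes "chain K a ms" "i \<le> j" "j \<le> length ms"
  shows "segment L (fo a) (map fm ms) i j = fm (segment K a ms i j)"
  using composite_map[OF source.chain_segment(1)[OF assms]] assms
  by (simp add: segment_def vertex_map drop_map take_map)

lemma nerve_map_simplex:
  "x \<in> simplices (nerve K) n \<Longrightarrow> nerve_map fo fm n x \<in> simplices (nerve L) n"
  by (auto simp: nerve_def nerve_map_def chain_map)

lemma nerve_map_pull:
  assumes "\<alpha> \<in> Delta_hom m n" "x \<in> simplices (nerve K) n"
  shows "nerve_map fo fm m (pull (nerve K) m n \<alpha> x)
    = pull (nerve L) m n \<alpha> (nerve_map fo fm n x)"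
proof -
  obtain a ms where x: "x = (a, ms)" "chain K a ms" "n = length ms"
    using assms(2) by (auto simp: nerve_def)
  note \<alpha> = assms(1)[unfolded x(3)]
  show ?thesis
    using x(1,2)
    by (auto simp: nerve_def nerve_map_def nerve_pull_segment vertex_map segment_map
        Delta_hom_le[OF \<alpha>] Delta_hom_mono[OF \<alpha>])
qed

end


section \<open>Quotients of simplicial sets\<close>

text \<open>Dimensionwise inverses commute with the structure maps automatically: \<open>f\<close>
  does, and it is injective in each dimension.\<close>

lemma sset_iso_iff_bij:
  assumes "sset_map X Y f"
  shows "sset_iso X Y f \<longleftrightarrow> (\<forall>n. bij_betw (f n) (simplices X n) (simplices Y n))"
proof
  assume "sset_iso X Y f"
  then obtain h where h: "sset_map Y X h"
    "\<And>n x. x \<in> simplices X n \<Longrightarrow> h n (f n x) = x"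
    "\<And>n y. y \<in> simplices Y n \<Longrightarrow> f n (h n y) = y"
    unfolding sset_iso_def by blast
  show "\<forall>n. bij_betw (f n) (simplices X n) (simplices Y n)"
  proof
    fix n
    show "bij_betw (f n) (simplices X n) (simplices Y n)"
      using h sset_map.map_simp[OF assms] sset_map.map_simp[OF h(1)]
      by (intro bij_betw_byWitness[where f' = "h n"]) auto
  qed
next
  interpret f: sset_map X Y f by (rule assms)
  assume bij: "\<forall>n. bij_betw (f n) (simplices X n) (simplices Y n)"
  define h where "h n = inv_into (simplices X n) (f n)" for n
  have h: "h n y \<in> simplices X n" "f n (h n y) = y" if "y \<in> simplices Y n" for n y
    using bij that unfolding h_def by (auto simp: bij_betw_def inv_into_into f_inv_into_f)
  have hf: "h n (f n x) = x" if "x \<in> simplices X n" for n x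
    using bij that unfolding h_def by (auto simp: bij_betw_def)
  have "sset_map Y X h"
  proof
    fix \<alpha> m n y
    assume \<alpha>: "\<alpha> \<in> Delta_hom m n" and y: "y \<in> simplices Y n"
    have "h m (pull Y m n \<alpha> y) = h m (f m (pull X m n \<alpha> (h n y)))"
      using f.map_pull[OF \<alpha>] h y by simp
    then show "h m (pull Y m n \<alpha> y) = pull X m n \<alpha> (h n y)"
      using hf f.source.pull_simp[OF \<alpha>] h y by simp
  qed (use h in auto)
  then show "sset_iso X Y f"
    unfolding sset_iso_def using assms hf h by blast
qed

lemma pull_image_orbit:
  assumes "\<And>g. g \<in> carrier G \<Longrightarrow> pull X m n \<alpha> (\<rho> n g x) = \<rho> m g (pull X m n \<alpha> x)"
  shows "pull X m n \<alpha> ` orbit G (\<rho> n) x = orbit G (\<rho> m) (pull X m n \<alpha> x)"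
  unfolding orbit_def using assms by (force simp: image_iff)

lemma simplicial_set_quot_sset:
  assumes "simplicial_set X"
    and \<rho>: "\<And>n g x. g \<in> carrier G \<Longrightarrow> x \<in> simplices X n \<Longrightarrow> \<rho> n g x \<in> simplices X n"
    and pull: "\<And>m n \<alpha> g x. g \<in> carrier G \<Longrightarrow> \<alpha> \<in> Delta_hom m n \<Longrightarrow> x \<in> simplices X n
      \<Longrightarrow> pull X m n \<alpha> (\<rho> n g x) = \<rho> m g (pull X m n \<alpha> x)"
  shows "simplicial_set (quot_sset G X \<rho>)"
proof -
  interpret simplicial_set X by fact
  have sub: "S \<subseteq> simplices X n" if "S \<in> orbits G (simplices X n) (\<rho> n)" for S n
    using that \<rho> by (auto simp: orbits_def orbit_def)
  show ?thesis
  proof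
    fix \<alpha> m n S
    assume \<alpha>: "\<alpha> \<in> Delta_hom m n" and "S \<in> simplices (quot_sset G X \<rho>) n"
    then obtain x where x: "x \<in> simplices X n" "S = orbit G (\<rho> n) x"
      by (auto simp: quot_sset_def orbits_def)
    then show "pull (quot_sset G X \<rho>) m n \<alpha> S \<in> simplices (quot_sset G X \<rho>) m"
      using pull_image_orbit[of G X m n \<alpha> \<rho> x] pull \<alpha> pull_simp
      by (auto simp: quot_sset_def orbits_def)
  next
    fix n S
    assume "S \<in> simplices (quot_sset G X \<rho>) n"
    then have "S \<subseteq> simplices X n" using sub by (simp add: quot_sset_def)
    then show "pull (quot_sset G X \<rho>) n n (\<lambda>i \<in> {..n}. i) S = S"
      using pull_id by (force simp: quot_sset_def image_iff)
  next
    fix \<alpha> \<beta> l m n S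
    assume \<beta>: "\<beta> \<in> Delta_hom l m" and \<alpha>: "\<alpha> \<in> Delta_hom m n"
      and "S \<in> simplices (quot_sset G X \<rho>) n"
    then have "S \<subseteq> simplices X n" using sub by (simp add: quot_sset_def)
    then show "pull (quot_sset G X \<rho>) l n (compose {..l} \<alpha> \<beta>) S
        = pull (quot_sset G X \<rho>) l m \<beta> (pull (quot_sset G X \<rho>) m n \<alpha> S)"
      unfolding quot_sset_def sset_data.simps image_image
      using pull_compose[OF \<beta> \<alpha>] by (intro image_cong) auto
  qed
qed


section \<open>The quotient category\<close>

lemma (in group_action) orbit_subset:
  assumes "x \<in> E" "y \<in> orbit G \<phi> x"
  shows "orbit G \<phi> y \<subseteq> orbit G \<phi> x"
proof
  interpret group_hom G "BijGroup E" \<phi> by (rule group_hom)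
  fix z assume "z \<in> orbit G \<phi> y"
  then obtain g h where gh: "g \<in> carrier G" "y = \<phi> g x" "h \<in> carrier G" "z = \<phi> h y"
    using assms(2) by (auto simp: orbit_def)
  then have "z = \<phi> (h \<otimes> g) x" by (simp only: composition_rule[OF assms(1)])
  then show "z \<in> orbit G \<phi> x" unfolding orbit_def using gh by blast
qed

lemma (in group_action) orbit_eq_iff:
  assumes "x \<in> E" "y \<in> E"
  shows "orbit G \<phi> x = orbit G \<phi> y \<longleftrightarrow> (\<exists>g \<in> carrier G. \<phi> g x = y)"
proof -
  have "orbit G \<phi> x = orbit G \<phi> y \<longleftrightarrow> y \<in> orbit G \<phi> x"
    using orbit_refl[OF assms(2)] orbit_sym[OF assms] orbit_subset[of x y] orbit_subset[of y x] assms
    by blast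
  then show ?thesis unfolding orbit_def[of G \<phi> x] by blast
qed

text \<open>As an equation of lists, orbitwise equality of decompositions can be reversed,
  concatenated and split by rewriting.\<close>

lemma quot_rel_iff:
  "(x, y) \<in> quot_rel G K aM \<longleftrightarrow> (\<exists>a b xs ys. xs \<noteq> [] \<and> chain K a xs \<and> chain K b ys
     \<and> x = composite K a xs \<and> y = composite K b ys
     \<and> map (orbit G aM) xs = map (orbit G aM) ys)"
proof -
  have "list_all2 (\<lambda>u v. orbit G aM u = orbit G aM v) xs ys
      \<longleftrightarrow> map (orbit G aM) xs = map (orbit G aM) ys" for xs ys
    by (auto simp: list_all2_conv_all_nth list_eq_iff_nth_eq)
  then show ?thesis by (simp add: quot_rel_def)
qed

context cat_action
begin

lemma orbit_aO_eq_iff: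
  "x \<in> Obj K \<Longrightarrow> y \<in> Obj K \<Longrightarrow>
    orbit G aO x = orbit G aO y \<longleftrightarrow> (\<exists>g \<in> carrier G. aO g x = y)"
  by (rule on_Obj.orbit_eq_iff)

lemma orbit_aM_eq_iff:
  "x \<in> Mor K \<Longrightarrow> y \<in> Mor K \<Longrightarrow>
    orbit G aM x = orbit G aM y \<longleftrightarrow> (\<exists>g \<in> carrier G. aM g x = y)"
  by (rule on_Mor.orbit_eq_iff)

lemma aM_Mor: "g \<in> carrier G \<Longrightarrow> m \<in> Mor K \<Longrightarrow> aM g m \<in> Mor K"
  and aO_Obj: "g \<in> carrier G \<Longrightarrow> a \<in> Obj K \<Longrightarrow> aO g a \<in> Obj K"
  and src_aM: "g \<in> carrier G \<Longrightarrow> m \<in> Mor K \<Longrightarrow> src K (aM g m) = aO g (src K m)"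
  and tgt_aM: "g \<in> carrier G \<Longrightarrow> m \<in> Mor K \<Longrightarrow> tgt K (aM g m) = aO g (tgt K m)"
  and aM_idm: "g \<in> carrier G \<Longrightarrow> a \<in> Obj K \<Longrightarrow> aM g (idm K a) = idm K (aO g a)"
  and aM_cmp: "g \<in> carrier G \<Longrightarrow> m \<in> Mor K \<Longrightarrow> n \<in> Mor K \<Longrightarrow> tgt K m = src K n
    \<Longrightarrow> aM g (cmp K n m) = cmp K (aM g n) (aM g m)"
  using cat_functor.fm_Mor[OF functorial] cat_functor.fo_Obj[OF functorial]
    cat_functor.src_fm[OF functorial] cat_functor.tgt_fm[OF functorial]
    cat_functor.fm_idm[OF functorial] cat_functor.fm_cmp[OF functorial]
  by blast+

lemma orbit_src: "x \<in> Mor K \<Longrightarrow> y \<in> Mor K \<Longrightarrow> orbit G aM x = orbit G aM y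
    \<Longrightarrow> orbit G aO (src K x) = orbit G aO (src K y)"
  and orbit_tgt: "x \<in> Mor K \<Longrightarrow> y \<in> Mor K \<Longrightarrow> orbit G aM x = orbit G aM y
    \<Longrightarrow> orbit G aO (tgt K x) = orbit G aO (tgt K y)"
  by (auto simp: orbit_aM_eq_iff orbit_aO_eq_iff src_Obj tgt_Obj aM_Mor src_aM tgt_aM)

text \<open>Restores composability: a morphism that fits only up to the action is replaced by a
  fitting one from its own orbit.\<close>

lemma translate_src:
  assumes "y \<in> Mor K" "a \<in> Obj K" "orbit G aO (src K y) = orbit G aO a"
  obtains y' where "y' \<in> Mor K" "src K y' = a" "orbit G aM y' = orbit G aM y"
proof -
  obtain g where g: "g \<in> carrier G" "aO g (src K y) = a"
    using assms by (auto simp: orbit_aO_eq_iff src_Obj)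
  then have "orbit G aM y = orbit G aM (aM g y)"
    using assms by (auto simp: orbit_aM_eq_iff aM_Mor)
  then show ?thesis using that[of "aM g y"] g assms by (simp add: aM_Mor src_aM)
qed

lemma translate_tgt:
  assumes "y \<in> Mor K" "a \<in> Obj K" "orbit G aO (tgt K y) = orbit G aO a"
  obtains y' where "y' \<in> Mor K" "tgt K y' = a" "orbit G aM y' = orbit G aM y"
proof -
  obtain g where g: "g \<in> carrier G" "aO g (tgt K y) = a"
    using assms by (auto simp: orbit_aO_eq_iff tgt_Obj)
  then have "orbit G aM y = orbit G aM (aM g y)"
    using assms by (auto simp: orbit_aM_eq_iff aM_Mor)
  then show ?thesis using that[of "aM g y"] g assms by (simp add: aM_Mor tgt_aM)
qed

section \<open>The generating relation and its compatibility with composition\<close>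

abbreviation R where "R \<equiv> quot_rel G K aM"
abbreviation cls where "cls \<equiv> quot_class G K aM"
abbreviation Q where "Q \<equiv> quot_cat G K aO aM"

lemma R_orbit:
  assumes "x \<in> Mor K" "y \<in> Mor K" "orbit G aM x = orbit G aM y"
  shows "(x, y) \<in> R"
  unfolding quot_rel_iff using assms
  by (intro exI[of _ "src K x"] exI[of _ "src K y"] exI[of _ "[x]"] exI[of _ "[y]"])
    (auto simp: cmp_idm_left tgt_Obj)

lemma R_sym: "(x, y) \<in> R \<Longrightarrow> (y, x) \<in> R"
  unfolding quot_rel_iff by (metis map_is_Nil_conv)

lemma R_Mor: "(x, y) \<in> R \<Longrightarrow> x \<in> Mor K \<and> y \<in> Mor K"
  unfolding quot_rel_iff using composite_Mor by blast

text \<open>A composite inherits its source from the first factor and its target from the last, and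
  corresponding factors share an orbit. Nonempty decompositions are essential here.\<close>

lemma R_ends:
  assumes "(x, y) \<in> R"
  shows "orbit G aO (src K x) = orbit G aO (src K y)"
    and "orbit G aO (tgt K x) = orbit G aO (tgt K y)"
proof -
  obtain a b xs ys where *: "xs \<noteq> []" "chain K a xs" "chain K b ys"
    "x = composite K a xs" "y = composite K b ys" "map (orbit G aM) xs = map (orbit G aM) ys"
    using assms unfolding quot_rel_iff by blast
  then have len: "length xs = length ys" by (metis length_map)
  have nth: "orbit G aM (xs ! i) = orbit G aM (ys ! i)" if "i < length xs" for i
    using *(6) that len by (metis nth_map)
  obtain u us v vs where uv: "xs = u # us" "ys = v # vs"
    using * by (cases xs; cases ys) auto
  show "orbit G aO (src K x) = orbit G aO (src K y)"
    using * uv orbit_src[of u v] composite_Mor[of a xs] composite_Mor[of b ys] by auto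
  show "orbit G aO (tgt K x) = orbit G aO (tgt K y)"
    using * uv len nth[of "length us"] orbit_tgt[of "xs ! length us" "ys ! length us"]
      composite_Mor[of a xs] composite_Mor[of b ys] chain_nth_Mor[of K a xs] chain_nth_Mor[of K b ys]
    by simp
qed

text \<open>Concatenate the decompositions; both concatenations are chains since both composites are
  defined.\<close>

lemma R_cmp:
  assumes "(x, x') \<in> R" "(y, y') \<in> R" "tgt K x = src K y" "tgt K x' = src K y'"
  shows "(cmp K y x, cmp K y' x') \<in> R"
proof -
  obtain a b xs xs' where x: "xs \<noteq> []" "chain K a xs" "chain K b xs'"
    "x = composite K a xs" "x' = composite K b xs'" "map (orbit G aM) xs = map (orbit G aM) xs'"
    using assms unfolding quot_rel_iff by blast
  obtain c d ys ys' where y: "chain K c ys" "chain K d ys'"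
    "y = composite K c ys" "y' = composite K d ys'" "map (orbit G aM) ys = map (orbit G aM) ys'"
    using assms unfolding quot_rel_iff by blast
  have eq: "vertex K a xs (length xs) = c" "vertex K b xs' (length xs') = d"
    using x y assms(3,4) composite_Mor by simp_all
  then have "chain K a (xs @ ys)" "chain K b (xs' @ ys')"
    using x y by (auto simp: chain_append)
  then show ?thesis
    unfolding quot_rel_iff using x y eq
    by (intro exI[of _ a] exI[of _ b] exI[of _ "xs @ ys"] exI[of _ "xs' @ ys'"])
      (simp add: composite_append)
qed

lemma R_trancl_Mor: "(x, y) \<in> R\<^sup>+ \<Longrightarrow> x \<in> Mor K \<and> y \<in> Mor K"
  by (induction rule: trancl_induct) (auto dest: R_Mor)

lemma R_trancl_ends:
  assumes "(x, y) \<in> R\<^sup>+"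
  shows "orbit G aO (src K x) = orbit G aO (src K y)"
    and "orbit G aO (tgt K x) = orbit G aO (tgt K y)"
  using assms by (induction rule: trancl_induct) (auto dest: R_ends)

text \<open>The intermediate terms between \<open>x\<close> and \<open>x'\<close> end at different
  objects of one orbit, so no single \<open>y\<close> composes with all of them. Each step of
  \<open>R\<close> therefore moves \<open>y\<close> to another member of its orbit, whence the
  existential.\<close>

lemma R_trancl_cmp_left:
  assumes "(x, x') \<in> R\<^sup>+" "y \<in> Mor K" "tgt K x = src K y"
  shows "\<exists>y' \<in> Mor K. orbit G aM y' = orbit G aM y \<and> tgt K x' = src K y'
    \<and> (cmp K y x, cmp K y' x') \<in> R\<^sup>+"
proof -
  have one: "\<exists>y' \<in> Mor K. orbit G aM y' = orbit G aM y \<and> tgt K z = src K y'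
      \<and> (cmp K y x, cmp K y' z) \<in> R"
    if xz: "(x, z) \<in> R" and y: "y \<in> Mor K" "tgt K x = src K y" for x y z
  proof -
    obtain y' where y': "y' \<in> Mor K" "src K y' = tgt K z" "orbit G aM y' = orbit G aM y"
      using translate_src[of y "tgt K z"] y R_ends(2)[OF xz] R_Mor[OF xz] tgt_Obj by metis
    then show ?thesis using R_cmp[OF xz R_orbit[of y y']] y by auto
  qed
  show ?thesis using assms(1)
  proof (induction rule: trancl_induct)
    case (base z)
    then show ?case using one[OF base assms(2,3)] by blast
  next
    case (step z w)
    then obtain y' where y': "y' \<in> Mor K" "orbit G aM y' = orbit G aM y" "tgt K z = src K y'"
      "(cmp K y x, cmp K y' z) \<in> R\<^sup>+" by blast
    then show ?case using one[OF step(2), of y'] by (metis trancl_into_trancl)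
  qed
qed

lemma R_trancl_cmp_right:
  assumes "(y, y') \<in> R\<^sup>+" "x \<in> Mor K" "tgt K x = src K y"
  shows "\<exists>x' \<in> Mor K. orbit G aM x' = orbit G aM x \<and> tgt K x' = src K y'
    \<and> (cmp K y x, cmp K y' x') \<in> R\<^sup>+"
proof -
  have one: "\<exists>x' \<in> Mor K. orbit G aM x' = orbit G aM x \<and> tgt K x' = src K z
      \<and> (cmp K y x, cmp K z x') \<in> R"
    if yz: "(y, z) \<in> R" and x: "x \<in> Mor K" "tgt K x = src K y" for x y z
  proof -
    obtain x' where x': "x' \<in> Mor K" "tgt K x' = src K z" "orbit G aM x' = orbit G aM x"
      using translate_tgt[of x "src K z"] x R_ends(1)[OF yz] R_Mor[OF yz] src_Obj by metis
    then show ?thesis using R_cmp[OF R_orbit[of x x'] yz] x by auto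
  qed
  show ?thesis using assms(1)
  proof (induction rule: trancl_induct)
    case (base z)
    then show ?case using one[OF base assms(2,3)] by blast
  next
    case (step z w)
    then obtain x' where x': "x' \<in> Mor K" "orbit G aM x' = orbit G aM x" "tgt K x' = src K z"
      "(cmp K y x, cmp K z x') \<in> R\<^sup>+" by blast
    then show ?case using one[OF step(2), of x'] by (metis trancl_into_trancl)
  qed
qed

text \<open>Well-definedness of composition in \<open>K/G\<close>. Varying \<open>x\<close> to
  \<open>x'\<close> drags \<open>y\<close> to a translate \<open>y1\<close>; varying
  \<open>y1\<close> to \<open>y'\<close> then drags \<open>x'\<close> to a translate
  \<open>x1\<close>.\<close>

lemma R_trancl_cmp:
  assumes x: "(x, x') \<in> R\<^sup>+" and y: "(y, y') \<in> R\<^sup>+"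
    and "tgt K x = src K y" "tgt K x' = src K y'"
  shows "(cmp K y x, cmp K y' x') \<in> R\<^sup>+"
proof -
  have Mor: "x \<in> Mor K" "x' \<in> Mor K" "y \<in> Mor K" "y' \<in> Mor K"
    using R_trancl_Mor x y by auto
  obtain y1 where y1: "y1 \<in> Mor K" "orbit G aM y1 = orbit G aM y" "tgt K x' = src K y1"
    "(cmp K y x, cmp K y1 x') \<in> R\<^sup>+"
    using R_trancl_cmp_left[OF x] Mor assms(3) by blast
  have "(y1, y') \<in> R\<^sup>+"
    using R_orbit[of y1 y] y1 Mor y by (meson trancl_into_trancl2)
  then obtain x1 where x1: "x1 \<in> Mor K" "orbit G aM x1 = orbit G aM x'" "tgt K x1 = src K y'"
    "(cmp K y1 x', cmp K y' x1) \<in> R\<^sup>+"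
    using R_trancl_cmp_right[of y1 y' x'] Mor y1 by blast
  \<comment> \<open>The detour may end at \<open>x1\<close> instead of \<open>x'\<close>, but the
    two share an orbit and both compose with \<open>y'\<close>, so one more step of \<open>R\<close>
    closes the gap.\<close>
  have "(cmp K y' x1, cmp K y' x') \<in> R"
    using R_cmp[OF R_orbit[of x1 x'] R_orbit[of y' y']] x1 Mor assms by auto
  with y1 x1 show ?thesis by (meson trancl_trans trancl_into_trancl)
qed

text \<open>On \<open>Mor K\<close> the relation \<open>R\<close> is reflexive and symmetric, so its
  transitive closure is an equivalence there.\<close>

lemma cls_eq_iff: "x \<in> Mor K \<Longrightarrow> y \<in> Mor K \<Longrightarrow> cls x = cls y \<longleftrightarrow> (x, y) \<in> R\<^sup>+"
proof -
  assume "x \<in> Mor K" "y \<in> Mor K"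
  then have refl: "(y, y) \<in> R\<^sup>+" using R_orbit by blast
  have "sym (R\<^sup>+)" by (rule sym_trancl) (simp add: symI R_sym)
  then have "\<And>x y. (x, y) \<in> R\<^sup>+ \<Longrightarrow> (y, x) \<in> R\<^sup>+" by (auto dest: symD)
  with refl show ?thesis by (auto simp: quot_class_def set_eq_iff intro: trancl_trans)
qed

lemma cls_memD: "y \<in> cls x \<Longrightarrow> x \<in> Mor K \<and> y \<in> Mor K \<and> cls y = cls x"
proof -
  assume "y \<in> cls x"
  then have "(x, y) \<in> R\<^sup>+" by (simp add: quot_class_def)
  then show ?thesis using R_trancl_Mor[of x y] cls_eq_iff[of x y] by simp
qed

lemma cls_self: "x \<in> Mor K \<Longrightarrow> x \<in> cls x"
  using R_orbit by (auto simp: quot_class_def)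

lemma cls_ends:
  assumes "x \<in> Mor K" "y \<in> Mor K" "cls x = cls y"
  shows "orbit G aO (src K x) = orbit G aO (src K y)"
    and "orbit G aO (tgt K x) = orbit G aO (tgt K y)"
  using R_trancl_ends assms by (simp_all add: cls_eq_iff)

lemma cls_orbit: "x \<in> Mor K \<Longrightarrow> y \<in> Mor K \<Longrightarrow> orbit G aM x = orbit G aM y \<Longrightarrow> cls x = cls y"
  using R_orbit by (auto simp: cls_eq_iff)

section \<open>Structure maps of the quotient category and the projection\<close>

lemma Q_Obj: "Obj Q = orbit G aO ` Obj K"
  by (auto simp: quot_cat_def orbits_def)

lemma Q_Mor: "Mor Q = cls ` Mor K"
  by (simp add: quot_cat_def)

lemma Q_src: "x \<in> Mor K \<Longrightarrow> src Q (cls x) = orbit G aO (src K x)"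
proof -
  assume x: "x \<in> Mor K"
  then have "(\<lambda>y. orbit G aO (src K y)) ` cls x = {orbit G aO (src K x)}"
    using cls_self[OF x] cls_memD cls_ends(1) by blast
  then show ?thesis by (simp add: quot_cat_def)
qed

lemma Q_tgt: "x \<in> Mor K \<Longrightarrow> tgt Q (cls x) = orbit G aO (tgt K x)"
proof -
  assume x: "x \<in> Mor K"
  then have "(\<lambda>y. orbit G aO (tgt K y)) ` cls x = {orbit G aO (tgt K x)}"
    using cls_self[OF x] cls_memD cls_ends(2) by blast
  then show ?thesis by (simp add: quot_cat_def)
qed

lemma Q_idm: "a \<in> Obj K \<Longrightarrow> idm Q (orbit G aO a) = cls (idm K a)"
proof -
  assume a: "a \<in> Obj K"
  have "cls (idm K (aO g a)) = cls (idm K a)" if g: "g \<in> carrier G" for g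
  proof -
    have "orbit G aM (idm K a) = orbit G aM (aM g (idm K a))"
      using g a orbit_aM_eq_iff[of "idm K a" "aM g (idm K a)"] by (auto simp: idm_Mor aM_Mor)
    then show ?thesis
      using cls_orbit[of "idm K (aO g a)" "idm K a"] g a by (simp add: aM_idm idm_Mor aO_Obj)
  qed
  then have "(\<lambda>b. cls (idm K b)) ` orbit G aO a = {cls (idm K a)}"
    using on_Obj.orbit_refl[OF a] by (auto simp: orbit_def)
  then show ?thesis by (simp add: quot_cat_def)
qed

lemma Q_cmp:
  assumes "x \<in> Mor K" "y \<in> Mor K" "tgt K x = src K y"
  shows "cmp Q (cls y) (cls x) = cls (cmp K y x)"
proof -
  have "cls (cmp K v u) = cls (cmp K y x)"
    if "u \<in> cls x" "v \<in> cls y" "tgt K u = src K v" for u v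
    using that cls_memD[OF that(1)] cls_memD[OF that(2)] assms R_trancl_cmp[of u x v y]
      cls_eq_iff[of u x] cls_eq_iff[of v y] cls_eq_iff[of "cmp K v u" "cmp K y x"]
    by (simp add: cmp_Mor)
  then have "{cls (cmp K v u) | v u. v \<in> cls y \<and> u \<in> cls x \<and> tgt K u = src K v}
      = {cls (cmp K y x)}"
    using cls_self assms by blast
  then show ?thesis by (simp add: quot_cat_def)
qed

text \<open>Prescribing the source lets lifts be chosen one after another so that they compose. The
  category axioms of \<open>Q\<close> thus reduce to those of \<open>K\<close>.\<close>

lemma Q_lift:
  assumes "Y \<in> Mor Q" "a \<in> Obj K" "src Q Y = orbit G aO a"
  obtains y where "y \<in> Mor K" "src K y = a" "Y = cls y"
proof -
  obtain z where z: "z \<in> Mor K" "Y = cls z" using assms(1) by (auto simp: Q_Mor)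
  then obtain y where "y \<in> Mor K" "src K y = a" "orbit G aM y = orbit G aM z"
    using translate_src[of z a] assms by (metis Q_src)
  then show ?thesis using that z cls_orbit by metis
qed

lemma category_Q: "category Q"
proof
  fix m assume "m \<in> Mor Q"
  then obtain x where [simp]: "m = cls x" and x: "x \<in> Mor K" by (auto simp: Q_Mor)
  show "src Q m \<in> Obj Q" "tgt Q m \<in> Obj Q"
    using x by (auto simp: Q_src Q_tgt Q_Obj src_Obj tgt_Obj)
  show "cmp Q m (idm Q (src Q m)) = m" "cmp Q (idm Q (tgt Q m)) m = m"
    using x
    by (simp_all add: Q_src Q_tgt Q_idm Q_cmp src_Obj tgt_Obj idm_Mor src_idm tgt_idm
        cmp_idm_left cmp_idm_right)
next
  fix A assume "A \<in> Obj Q"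
  then show "idm Q A \<in> Mor Q" "src Q (idm Q A) = A" "tgt Q (idm Q A) = A"
    by (auto simp: Q_Obj Q_Mor Q_idm Q_src Q_tgt idm_Mor src_idm tgt_idm)
next
  fix X Y assume *: "X \<in> Mor Q" "Y \<in> Mor Q" "tgt Q X = src Q Y"
  obtain x where x: "x \<in> Mor K" "X = cls x" using * by (auto simp: Q_Mor)
  obtain y where y: "y \<in> Mor K" "src K y = tgt K x" "Y = cls y"
    using Q_lift[of Y "tgt K x"] * x by (metis Q_tgt tgt_Obj)
  show "cmp Q Y X \<in> Mor Q" "src Q (cmp Q Y X) = src Q X" "tgt Q (cmp Q Y X) = tgt Q Y"
    using x y by (auto simp: Q_cmp Q_Mor Q_src Q_tgt cmp_Mor src_cmp tgt_cmp)
  fix Z assume **: "Z \<in> Mor Q" "tgt Q Y = src Q Z"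
  obtain z where z: "z \<in> Mor K" "src K z = tgt K y" "Z = cls z"
    using Q_lift[of Z "tgt K y"] ** y by (metis Q_tgt tgt_Obj)
  show "cmp Q Z (cmp Q Y X) = cmp Q (cmp Q Z Y) X"
    using x y z by (simp add: Q_cmp cmp_Mor src_cmp tgt_cmp cmp_assoc)
qed

lemma cat_functor_projection: "cat_functor K Q (orbit G aO) cls"
proof -
  interpret category Q by (rule category_Q)
  show ?thesis
    by unfold_locales (auto simp: Q_Obj Q_Mor Q_src Q_tgt Q_idm Q_cmp)
qed

end


section \<open>Degenerate entries of chains and the lifting condition\<close>

text \<open>A simplex of the nerve is a degeneracy of one of dimension \<open>nondeg K ms\<close>.\<close>

definition nondeg :: "('o, 'm) cat_data \<Rightarrow> 'm list \<Rightarrow> nat" where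
  "nondeg K ms = length (filter (\<lambda>m. m \<noteq> idm K (src K m)) ms)"

lemma nondeg_simps [simp]:
  "nondeg K [] = 0"
  "nondeg K (m # ms) = (if m = idm K (src K m) then nondeg K ms else Suc (nondeg K ms))"
  "nondeg K (xs @ ys) = nondeg K xs + nondeg K ys"
  by (auto simp: nondeg_def)

lemma nondeg_le_length: "nondeg K ms \<le> length ms"
  by (simp add: nondeg_def)

context category
begin

lemma chain_iff_nth:
  "chain K a ms \<longleftrightarrow> a \<in> Obj K \<and> (\<forall>i < length ms. ms ! i \<in> Mor K \<and> src K (ms ! i) = vertex K a ms i)"
proof (induction ms arbitrary: a)
  case (Cons m ms)
  then show ?case
    by (auto simp: All_less_Suc2 vertex_Cons_Suc src_Obj tgt_Obj simp del: vertex.simps(2))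
qed simp

text \<open>An identity entry leaves the current object unchanged, so its neighbours still compose
  after its removal.\<close>

lemma chain_filter_nondeg:
  assumes "chain K a ms"
  defines "fs \<equiv> filter (\<lambda>m. m \<noteq> idm K (src K m)) ms"
  shows "chain K a fs \<and> vertex K a fs (length fs) = vertex K a ms (length ms)"
  using assms(1) unfolding fs_def
proof (induction ms arbitrary: a)
  case (Cons m ms)
  then have "m = idm K (src K m) \<Longrightarrow> tgt K m = a"
    using tgt_idm[of a] by (metis chain.simps(2) src_Obj)
  with Cons show ?case by (auto simp: vertex_Cons_Suc simp del: vertex.simps(2))
qed simp

lemma chain_pad:
  assumes "chain K a ms"
  shows "chain K a (replicate n (idm K a) @ ms)
    \<and> vertex K a (replicate n (idm K a) @ ms) (n + length ms) = vertex K a ms (length ms)"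
  using assms chain_Obj[OF assms]
  by (induction n) (auto simp: vertex_Cons_Suc idm_Mor src_idm tgt_idm simp del: vertex.simps(2))

text \<open>Where \<alpha> is constant the segment is an identity, so every non-identity entry costs
  a strict increase of \<alpha>.\<close>

lemma nondeg_nerve_pull:
  assumes "chain K a ms" "\<alpha> \<in> Delta_hom m (length ms)" "j \<le> m"
  shows "nondeg K (map (\<lambda>i. segment K a ms (\<alpha> i) (\<alpha> (Suc i))) [0..<j]) \<le> \<alpha> j"
  using assms(3)
proof (induction j)
  case (Suc j)
  then have le: "\<alpha> j \<le> \<alpha> (Suc j)" using Delta_hom_mono[OF assms(2)] by simp
  show ?case
  proof (cases "\<alpha> j = \<alpha> (Suc j)")
    case True
    then have "vertex K a ms (\<alpha> j) \<in> Obj K"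
      using vertex_Obj[OF assms(1)] Delta_hom_le[OF assms(2)] Suc.prems by simp
    with True Suc show ?thesis by (simp add: segment_same src_idm)
  qed (use Suc le in simp)
qed simp

end

context cat_action
begin

text \<open>Translates the indexed family of \<open>condition_C\<close> into a list; entry
  \<open>i\<close> of the family, counted from 1, is \<open>ms ! (i - 1)\<close>.\<close>

lemma condition_C_chain:
  assumes "condition_C G K aM t" "t \<ge> 2" "chain K a ms" "length ms = t - 1"
    and "x \<in> Mor K" "y \<in> Mor K" "src K x = vertex K a ms (length ms)" "src K y = src K x"
    and "orbit G aM x = orbit G aM y"
  shows "\<exists>g \<in> carrier G. aM g x = y \<and> (\<forall>m \<in> set ms. aM g m = m)"
proof -
  let ?m = "\<lambda>i. ms ! (i - 1)"
  have nth: "ms ! i \<in> Mor K" "src K (ms ! i) = vertex K a ms i" if "i < t - 1" for i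
    using assms(3,4) that by (simp_all add: chain_iff_nth)
  have "vertex K a ms (t - 1) = tgt K (?m (t - 1))"
    using assms(2) by (cases "t - 1") auto
  moreover have "src K (?m i) = tgt K (?m (i - 1))" if "i \<in> {2..t - 1}" for i
  proof -
    have "i = Suc (Suc (i - 2))" using that by auto
    then obtain j where "i = Suc (Suc j)" ..
    then show ?thesis using that nth(2)[of "Suc j"] by simp
  qed
  moreover have "?m i \<in> Mor K" if "i \<in> {1..t - 1}" for i
    using nth(1)[of "i - 1"] that by auto
  ultimately have "\<exists>g \<in> carrier G. aM g x = y \<and> (\<forall>i \<in> {1..t - 1}. aM g (?m i) = ?m i)"
    using assms(4-9) by (intro assms(1)[unfolded condition_C_def, rule_format]) simp
  then obtain g where g: "g \<in> carrier G" "aM g x = y"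
    "\<And>i. i \<in> {1..t - 1} \<Longrightarrow> aM g (?m i) = ?m i"
    by blast
  have "aM g m = m" if "m \<in> set ms" for m
  proof -
    obtain j where "j < t - 1" "m = ms ! j" using \<open>m \<in> set ms\<close> assms(4) by (metis in_set_conv_nth)
    then show ?thesis using g(3)[of "Suc j"] by simp
  qed
  with g show ?thesis by blast
qed

lemma condition_CI:
  assumes "t \<ge> 2"
    and lift: "\<And>a ms x y. \<lbrakk>chain K a ms; length ms = t - 1; x \<in> Mor K; y \<in> Mor K;
      src K x = vertex K a ms (length ms); src K y = src K x; orbit G aM x = orbit G aM y\<rbrakk>
      \<Longrightarrow> \<exists>g \<in> carrier G. aM g x = y \<and> (\<forall>m \<in> set ms. aM g m = m)"
  shows "condition_C G K aM t"
  unfolding condition_C_def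
proof (intro allI impI, elim conjE)
  fix m x y
  assume Mor: "\<forall>i \<in> {1..t - 1}. m i \<in> Mor K"
    and comp: "\<forall>i \<in> {2..t - 1}. src K (m i) = tgt K (m (i - 1))"
    and xy: "x \<in> Mor K" "y \<in> Mor K" "src K x = tgt K (m (t - 1))" "src K y = tgt K (m (t - 1))"
      "orbit G aM x = orbit G aM y"
  \<comment> \<open>Since \<open>t \<ge> 2\<close>, the entry \<open>m 1\<close> exists and
    determines the initial object.\<close>
  let ?ms = "map m [1..<t]" and ?a = "src K (m 1)"
  have "chain K ?a ?ms"
    unfolding chain_iff_nth
  proof (intro conjI allI impI)
    show "?a \<in> Obj K" using Mor assms(1) by (auto intro!: src_Obj)
    fix i assume i: "i < length ?ms"
    then show "?ms ! i \<in> Mor K" using Mor by auto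
    show "src K (?ms ! i) = vertex K ?a ?ms i"
      using i comp by (cases i) auto
  qed
  moreover have "vertex K ?a ?ms (length ?ms) = tgt K (m (t - 1))"
    using assms(1) by (cases "t - 1") auto
  ultimately obtain g where "g \<in> carrier G" "aM g x = y" "\<And>m. m \<in> set ?ms \<Longrightarrow> aM g m = m"
    using lift[of ?a ?ms x y] xy by auto
  then show "\<exists>g \<in> carrier G. aM g x = y \<and> (\<forall>i \<in> {1..t - 1}. aM g (m i) = m i)"
    using assms(1) by (intro bexI[of _ g]) auto
qed

text \<open>Fixedness propagates along the chain: if the current object is fixed, so is an identity
  on it, and any other entry is fixed by assumption. Either way the next object is fixed.\<close>

lemma chain_fixed:
  assumes "chain K a ms" "g \<in> carrier G" "aO g a = a"
    and "\<And>m. m \<in> set ms \<Longrightarrow> m \<noteq> idm K (src K m) \<Longrightarrow> aM g m = m"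
  shows "\<forall>m \<in> set ms. aM g m = m"
  using assms(1,3,4)
proof (induction ms arbitrary: a)
  case (Cons m ms)
  then have m: "m \<in> Mor K" "src K m = a" "chain K (tgt K m) ms" by auto
  have "aM g m = m"
  proof (cases "m = idm K (src K m)")
    case True
    then show ?thesis
      using aM_idm[OF assms(2), of a] m Cons.prems(2) src_Obj[OF m(1)] by simp
  qed (use Cons in auto)
  moreover from this have "aO g (tgt K m) = tgt K m"
    using tgt_aM[OF assms(2) m(1)] by simp
  ultimately show ?case using Cons m by auto
qed simp

text \<open>Identities may be dropped from, or added to, the chain that the lifted element has to fix.\<close>

lemma condition_C_nondeg:
  assumes "condition_C G K aM t" "t \<ge> 2" "chain K a ms" "nondeg K ms < t"
    and "x \<in> Mor K" "y \<in> Mor K" "src K x = vertex K a ms (length ms)" "src K y = src K x"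
    and "orbit G aM x = orbit G aM y"
  shows "\<exists>g \<in> carrier G. aO g a = a \<and> aM g x = y \<and> (\<forall>m \<in> set ms. aM g m = m)"
proof -
  let ?fs = "filter (\<lambda>m. m \<noteq> idm K (src K m)) ms"
  \<comment> \<open>The padding goes in front so that the final object, where \<open>x\<close>
    starts, stays the same. The bound \<open>nondeg K ms < t\<close> ensures that the total length
    is exactly \<open>t - 1\<close>.\<close>
  let ?ps = "replicate (t - 1 - length ?fs) (idm K a) @ ?fs"
  have fs: "chain K a ?fs" "vertex K a ?fs (length ?fs) = vertex K a ms (length ms)"
    using chain_filter_nondeg[OF assms(3)] by auto
  have len: "length ?ps = t - 1" "length ?ps = t - 1 - length ?fs + length ?fs"
    using assms(4) by (auto simp: nondeg_def)
  have ps: "chain K a ?ps" "vertex K a ?ps (length ?ps) = vertex K a ms (length ms)"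
    using chain_pad[OF fs(1), of "t - 1 - length ?fs"] fs(2) unfolding len(2) by auto
  obtain g where g: "g \<in> carrier G" "aM g x = y" "\<And>m. m \<in> set ?ps \<Longrightarrow> aM g m = m"
    using condition_C_chain[OF assms(1,2) ps(1) len(1) assms(5,6)] ps(2) assms(7-9) by auto
  \<comment> \<open>The head of the nonempty list \<open>?ps\<close> starts at \<open>a\<close> and
    is fixed, hence \<open>a\<close> is fixed.\<close>
  obtain p ps where p: "?ps = p # ps" using len(1) assms(2) by (cases ?ps) auto
  then have "p \<in> Mor K" "src K p = a" "aM g p = p"
    using ps(1) g(3)[of p] by auto
  then have "aO g a = a" using src_aM[OF g(1), of p] by simp
  moreover from this have "\<forall>m \<in> set ms. aM g m = m"
    using chain_fixed[OF assms(3) g(1)] g(3) by auto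
  ultimately show ?thesis using g by blast
qed

section \<open>Classes as orbits, and matching of chains\<close>

lemma aM_mult:
  "g \<in> carrier G \<Longrightarrow> h \<in> carrier G \<Longrightarrow> m \<in> Mor K \<Longrightarrow> aM (h \<otimes>\<^bsub>G\<^esub> g) m = aM h (aM g m)"
  by (rule on_Mor.composition_rule)

lemma aO_mult:
  "g \<in> carrier G \<Longrightarrow> h \<in> carrier G \<Longrightarrow> a \<in> Obj K \<Longrightarrow> aO (h \<otimes>\<^bsub>G\<^esub> g) a = aO h (aO g a)"
  by (rule on_Obj.composition_rule)

lemma group_G: "group G"
  using on_Obj.group_hom by (simp add: group_hom_def)

text \<open>
  Under \<open>condition_C\<close> a decomposition is moved to an orbitwise equal one factor by factor: the
  composite of the factors already treated is the single morphism to be fixed.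
\<close>

lemma R_imp_orbit_eq:
  assumes C: "condition_C G K aM t" "t \<ge> 2" and "(x, y) \<in> R"
  shows "orbit G aM x = orbit G aM y"
proof -
  obtain a b xs ys where *: "xs \<noteq> []" "chain K a xs" "chain K b ys"
    "x = composite K a xs" "y = composite K b ys" "map (orbit G aM) xs = map (orbit G aM) ys"
    using assms(3) unfolding quot_rel_iff by blast
  have "\<exists>g \<in> carrier G. aM g (composite K a xs) = composite K b ys"
    using *(1,2,3,6)
  proof (induction xs arbitrary: ys rule: rev_nonempty_induct)
    case (single x)
    then obtain y where "ys = [y]" "orbit G aM x = orbit G aM y" by (cases ys) auto
    then show ?case
      using single orbit_aM_eq_iff[of x y] by (auto simp: composite_singleton simp del: composite.simps)
  next
    case (snoc x xs)
    obtain y ys' where ys: "ys = ys' @ [y]" using snoc.prems(3) by (cases ys rule: rev_cases) auto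
    let ?X = "composite K a xs" and ?Y = "composite K b ys'"
    have ch: "chain K a xs" "x \<in> Mor K" "src K x = vertex K a xs (length xs)"
      "chain K b ys'" "y \<in> Mor K" "src K y = vertex K b ys' (length ys')"
      using snoc.prems ys by (auto simp: chain_append)
    have eq: "map (orbit G aM) xs = map (orbit G aM) ys'" "orbit G aM x = orbit G aM y"
      using snoc.prems(3) ys by auto
    have X: "?X \<in> Mor K" "tgt K ?X = src K x" and Y: "?Y \<in> Mor K" "tgt K ?Y = src K y"
      using composite_Mor[OF ch(1)] composite_Mor[OF ch(4)] ch by auto
    obtain g where g: "g \<in> carrier G" "aM g ?X = ?Y"
      using snoc.IH[OF ch(1) ch(4) eq(1)] by blast
    have src: "src K (aM g x) = src K y"
      using src_aM[OF g(1) ch(2)] tgt_aM[OF g(1) X(1)] g(2) X(2) Y(2) by simp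
    have "orbit G aM x = orbit G aM (aM g x)"
      using orbit_aM_eq_iff[of x "aM g x"] ch(2) g(1) by (auto simp: aM_Mor)
    \<comment> \<open>The chain to be fixed is \<open>[?Y]\<close>; it has at most one non-identity
      entry, so any \<open>t \<ge> 2\<close> is large enough.\<close>
    then have "\<exists>h \<in> carrier G. aO h (src K ?Y) = src K ?Y \<and> aM h (aM g x) = y
        \<and> (\<forall>m \<in> set [?Y]. aM h m = m)"
      using C(2) src eq ch g Y nondeg_le_length[of K "[?Y]"]
      by (intro condition_C_nondeg[OF C]) (simp_all add: aM_Mor vertex_Obj del: nondeg_simps)
    then obtain h where h: "h \<in> carrier G" "aM h (aM g x) = y" "aM h ?Y = ?Y"
      by auto
    have "aM (h \<otimes>\<^bsub>G\<^esub> g) (cmp K x ?X) = cmp K y ?Y"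
      using g h X ch src Y by (simp add: aM_mult aM_cmp cmp_Mor aM_Mor)
    moreover have "composite K a (xs @ [x]) = cmp K x ?X" "composite K b ys = cmp K y ?Y"
      using composite_append snoc.prems(1,2) ys composite_singleton ch by metis+
    moreover have "h \<otimes>\<^bsub>G\<^esub> g \<in> carrier G"
      using g h group_G by (simp add: group.is_monoid monoid.m_closed)
    ultimately show ?case by metis
  qed
  then show ?thesis
    using * orbit_aM_eq_iff composite_Mor by simp
qed

lemma cls_eq_imp_orbit_eq:
  assumes "condition_C G K aM t" "t \<ge> 2" "x \<in> Mor K" "y \<in> Mor K" "cls x = cls y"
  shows "orbit G aM x = orbit G aM y"
proof -
  have "(x, y) \<in> R\<^sup>+" using assms by (simp add: cls_eq_iff)
  then show ?thesis
    by (induction rule: trancl_induct) (use R_imp_orbit_eq[OF assms(1,2)] in auto)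
qed

text \<open>Only one of the two chains in \<open>lift_chain_eq\<close> has a bound on
  \<open>nondeg\<close>; this carries the bound over to the part of the other that is already
  matched.\<close>

lemma nondeg_translate:
  assumes "g \<in> carrier G" "chain K a ms"
  shows "nondeg K (map (aM g) ms) \<le> nondeg K ms"
  using assms(2)
proof (induction ms arbitrary: a)
  case (Cons m ms)
  then have "nondeg K (map (aM g) ms) \<le> nondeg K ms" by auto
  moreover have "aM g m = idm K (src K (aM g m))" if "m = idm K (src K m)"
    using that Cons.prems aM_idm[OF assms(1), of a] src_aM[OF assms(1), of m] chain_Obj[OF Cons.prems]
    by auto
  ultimately show ?case by (cases "m = idm K (src K m)") simp_all
qed simp

text \<open>Entries are added at the end, as in (C_t), where the last morphism moves and the earlier
  ones stay. The bound includes that last entry, hence \<open>nondeg K ms \<le> t\<close> here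
  against \<open><\<close> in \<open>condition_C_nondeg\<close>. The hypothesis on \<open>a\<close>
  and \<open>b\<close> settles the empty chain.\<close>

lemma lift_chain_eq:
  assumes C: "condition_C G K aM t" "t \<ge> 2" and "chain K a ms" "chain K b ns"
    and "orbit G aO a = orbit G aO b" "map cls ms = map cls ns" "nondeg K ms \<le> t"
  shows "\<exists>g \<in> carrier G. aO g a = b \<and> map (aM g) ms = ns"
  using assms(3,4,6,7)
proof (induction ms arbitrary: ns rule: rev_induct)
  case Nil
  then show ?case using assms(5) by (simp add: orbit_aO_eq_iff)
next
  case (snoc m ms)
  obtain n ns' where ns: "ns = ns' @ [n]" using snoc.prems(3) by (cases ns rule: rev_cases) auto
  have ch: "chain K a ms" "m \<in> Mor K" "src K m = vertex K a ms (length ms)"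
    "chain K b ns'" "n \<in> Mor K" "src K n = vertex K b ns' (length ns')"
    using snoc.prems ns by (auto simp: chain_append)
  have cls: "map cls ms = map cls ns'" "cls m = cls n" using snoc.prems(3) ns by auto
  obtain g where g: "g \<in> carrier G" "aO g a = b" "map (aM g) ms = ns'"
    using snoc.IH[OF ch(1,4) cls(1)] snoc.prems(4) by fastforce
  have src: "src K (aM g m) = src K n"
    using src_aM[OF g(1) ch(2)] cat_functor.vertex_map[OF functorial[OF g(1)] ch(1), of "length ms"]
      g ch by auto
  have orb: "orbit G aM m = orbit G aM n" "orbit G aM m = orbit G aM (aM g m)"
    using cls_eq_imp_orbit_eq[OF C ch(2,5) cls(2)] orbit_aM_eq_iff[of m "aM g m"] ch(2) g(1)
    by (auto simp: aM_Mor)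
  show ?case
  proof (cases "m = idm K (src K m)")
    \<comment> \<open>All translates of an identity are identities; \<open>aM g m\<close> and
      \<open>n\<close> are two of them with the same source, hence equal without any
      correction.\<close>
    case True
    obtain k where k: "k \<in> carrier G" "n = aM k m"
      using orb(1) orbit_aM_eq_iff[OF ch(2,5)] by auto
    have "aM h m = idm K (src K (aM h m))" if "h \<in> carrier G" for h
      using aM_idm[OF that, of "src K m"] src_aM[OF that ch(2)] True src_Obj[OF ch(2)] by simp
    then have "aM g m = n" using k g(1) src by metis
    then show ?thesis using g ns by auto
  next
    case False
    \<comment> \<open>The entry \<open>m\<close> itself uses up one of the \<open>t\<close>
      admissible non-identities.\<close>
    then have "nondeg K ns' < t"
      using snoc.prems(4) nondeg_translate[OF g(1) ch(1)] g(3) by simp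
    then obtain h where h: "h \<in> carrier G" "aO h b = b" "aM h (aM g m) = n" "\<forall>x \<in> set ns'. aM h x = x"
      using condition_C_nondeg[OF C ch(4), of "aM g m" n] src orb ch g(1) by (auto simp: aM_Mor)
    have "map (aM (h \<otimes>\<^bsub>G\<^esub> g)) (ms @ [m]) = map (aM h) (map (aM g) (ms @ [m]))"
      using g(1) h(1) ch(2) chain_Mor[OF ch(1)] by (auto simp: aM_mult subset_iff)
    also have "\<dots> = ns" using g h ns by (simp add: map_idI)
    finally have "map (aM (h \<otimes>\<^bsub>G\<^esub> g)) (ms @ [m]) = ns" .
    moreover have "aO (h \<otimes>\<^bsub>G\<^esub> g) a = b" using g h chain_Obj[OF ch(1)] by (simp add: aO_mult)
    moreover have "h \<otimes>\<^bsub>G\<^esub> g \<in> carrier G"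
      using g h group_G by (simp add: group.is_monoid monoid.m_closed)
    ultimately show ?thesis by blast
  qed
qed


section \<open>The canonical map\<close>

abbreviation act where "act \<equiv> \<lambda>n g. nerve_map (aO g) (aM g) n"
abbreviation NQ where "NQ \<equiv> nerve_quot G K aO aM"
abbreviation lam where "lam \<equiv> canonical_map G K aO aM"

lemma nerve_simplex: "(a, ms) \<in> simplices (nerve K) n \<longleftrightarrow> length ms = n \<and> chain K a ms"
  by (simp add: nerve_def)

lemma simplexE:
  assumes "x \<in> simplices (nerve K) n"
  obtains a ms where "x = (a, ms)" "a \<in> Obj K" "\<And>m. m \<in> set ms \<Longrightarrow> m \<in> Mor K"
proof -
  obtain a ms where x: "x = (a, ms)" "chain K a ms" using assms by (cases x) (auto simp: nerve_simplex)
  show ?thesis using that[OF x(1) chain_Obj[OF x(2)]] chain_Mor[OF x(2)] by auto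
qed

lemma act_simplex:
  "g \<in> carrier G \<Longrightarrow> x \<in> simplices (nerve K) n \<Longrightarrow> act n g x \<in> simplices (nerve K) n"
  by (rule cat_functor.nerve_map_simplex[OF functorial])

lemma act_pull:
  "g \<in> carrier G \<Longrightarrow> \<alpha> \<in> Delta_hom m n \<Longrightarrow> x \<in> simplices (nerve K) n
    \<Longrightarrow> pull (nerve K) m n \<alpha> (act n g x) = act m g (pull (nerve K) m n \<alpha> x)"
  by (rule cat_functor.nerve_map_pull[OF functorial, symmetric])

lemma act_mult:
  assumes "g \<in> carrier G" "h \<in> carrier G" "x \<in> simplices (nerve K) n"
  shows "act n (h \<otimes>\<^bsub>G\<^esub> g) x = act n h (act n g x)"
proof -
  obtain a ms where x: "x = (a, ms)" "a \<in> Obj K" "\<And>m. m \<in> set ms \<Longrightarrow> m \<in> Mor K"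
    using simplexE[OF assms(3)] by blast
  with assms show ?thesis by (simp add: nerve_map_def aO_mult aM_mult)
qed

lemma act_one:
  assumes "x \<in> simplices (nerve K) n"
  shows "act n \<one>\<^bsub>G\<^esub> x = x"
proof -
  obtain a ms where x: "x = (a, ms)" "a \<in> Obj K" "\<And>m. m \<in> set ms \<Longrightarrow> m \<in> Mor K"
    using simplexE[OF assms] by blast
  then show ?thesis
    by (auto simp: nerve_map_def on_Obj.id_eq_one[symmetric] on_Mor.id_eq_one[symmetric]
        intro!: map_idI)
qed

text \<open>\<open>group_action\<close> asks for maps that are extensional on the set acted upon,
  which \<open>act n\<close> need not be; the usual argument is therefore run directly from
  \<open>act_one\<close> and \<open>act_mult\<close>.\<close>

lemma orbit_act_eq_iff:
  assumes x: "x \<in> simplices (nerve K) n" and y: "y \<in> simplices (nerve K) n"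
  shows "orbit G (act n) x = orbit G (act n) y \<longleftrightarrow> (\<exists>g \<in> carrier G. act n g x = y)"
proof
  interpret group G by (rule group_G)
  assume "orbit G (act n) x = orbit G (act n) y"
  moreover have "y \<in> orbit G (act n) y" unfolding orbit_def using act_one[OF y] one_closed by force
  ultimately have "y \<in> orbit G (act n) x" by simp
  then show "\<exists>g \<in> carrier G. act n g x = y" by (auto simp: orbit_def)
next
  interpret group G by (rule group_G)
  assume "\<exists>g \<in> carrier G. act n g x = y"
  then obtain g where g: "g \<in> carrier G" "act n g x = y" by blast
  have sub: "orbit G (act n) (act n h z) \<subseteq> orbit G (act n) z"
    if "h \<in> carrier G" "z \<in> simplices (nerve K) n" for h z
  proof
    fix w assume "w \<in> orbit G (act n) (act n h z)"
    then obtain k where "k \<in> carrier G" "w = act n k (act n h z)" by (auto simp: orbit_def)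
    then have "k \<otimes>\<^bsub>G\<^esub> h \<in> carrier G" "w = act n (k \<otimes>\<^bsub>G\<^esub> h) z" using that act_mult by auto
    then show "w \<in> orbit G (act n) z" unfolding orbit_def by blast
  qed
  have "act n (inv\<^bsub>G\<^esub> g) y = x"
    using g act_mult[of g "inv\<^bsub>G\<^esub> g" x n] act_one x by simp
  then show "orbit G (act n) x = orbit G (act n) y"
    using sub[of g x] sub[of "inv\<^bsub>G\<^esub> g" y] g x y by auto
qed

lemma NQ_simplices: "simplices NQ n = orbit G (act n) ` simplices (nerve K) n"
  by (auto simp: nerve_quot_def quot_sset_def orbits_def)

lemma NQ_pull:
  assumes "\<alpha> \<in> Delta_hom m n" "x \<in> simplices (nerve K) n"
  shows "pull NQ m n \<alpha> (orbit G (act n) x) = orbit G (act m) (pull (nerve K) m n \<alpha> x)"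
  using pull_image_orbit[of G "nerve K" m n \<alpha> act x] act_pull assms
  by (simp add: nerve_quot_def quot_sset_def)

lemma lam_orbit:
  assumes "x \<in> simplices (nerve K) n"
  shows "lam n (orbit G (act n) x) = nerve_map (orbit G aO) cls n x"
proof -
  obtain a ms where x: "x = (a, ms)" "chain K a ms" using assms by (cases x) (auto simp: nerve_simplex)
  have "nerve_map (orbit G aO) cls n (act n g x) = nerve_map (orbit G aO) cls n x"
    if g: "g \<in> carrier G" for g
  proof -
    have "orbit G aO a = orbit G aO (aO g a)"
      using g x chain_Obj orbit_aO_eq_iff aO_Obj by metis
    moreover have "cls (aM g m) = cls m" if "m \<in> set ms" for m
    proof -
      have "m \<in> Mor K" using that x chain_Mor[of K a ms] by auto
      then show ?thesis
        using g cls_orbit[of "aM g m" m] orbit_aM_eq_iff[of m "aM g m"] by (auto simp: aM_Mor)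
    qed
    ultimately show ?thesis using x by (simp add: nerve_map_def)
  qed
  then have "nerve_map (orbit G aO) cls n ` orbit G (act n) x
      = (\<lambda>_. nerve_map (orbit G aO) cls n x) ` orbit G (act n) x"
    by (intro image_cong) (auto simp: orbit_def)
  \<comment> \<open>A constant map has a singleton image only on a nonempty set; the unit of
    \<open>G\<close> provides an element of the orbit.\<close>
  moreover have "orbit G (act n) x \<noteq> {}"
    unfolding orbit_def using monoid.one_closed[OF group.is_monoid[OF group_G]] by blast
  ultimately have "nerve_map (orbit G aO) cls n ` orbit G (act n) x = {nerve_map (orbit G aO) cls n x}"
    by (simp add: image_constant_conv)
  then show ?thesis by (simp add: canonical_map_def)
qed

lemma simplicial_set_NQ: "simplicial_set NQ"
  unfolding nerve_quot_def
  by (rule simplicial_set_quot_sset[OF simplicial_set_nerve]) (auto simp: act_simplex act_pull)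

lemma sset_map_lam: "sset_map NQ (nerve Q) lam"
proof (intro sset_map.intro simplicial_set_NQ category.simplicial_set_nerve[OF category_Q]
    sset_map_axioms.intro)
  interpret P: cat_functor K Q "orbit G aO" cls by (rule cat_functor_projection)
  show "lam n S \<in> simplices (nerve Q) n" if "S \<in> simplices NQ n" for n S
    using that P.nerve_map_simplex by (auto simp: NQ_simplices lam_orbit)
  show "lam m (pull NQ m n \<alpha> S) = pull (nerve Q) m n \<alpha> (lam n S)"
    if "\<alpha> \<in> Delta_hom m n" "S \<in> simplices NQ n" for m n \<alpha> S
    using that P.nerve_map_pull simplicial_set.pull_simp[OF simplicial_set_nerve]
    by (auto simp: NQ_simplices NQ_pull lam_orbit)
qed

section \<open>Surjectivity and injectivity of the canonical map\<close>

text \<open>Each entry is lifted so as to start where the previous lift ends.\<close>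

lemma lift_chain:
  "chain Q (orbit G aO a) Ms \<Longrightarrow> a \<in> Obj K \<Longrightarrow> \<exists>ms. chain K a ms \<and> map cls ms = Ms"
proof (induction Ms arbitrary: a)
  case (Cons M Ms)
  then obtain y where y: "y \<in> Mor K" "src K y = a" "M = cls y" by (auto elim: Q_lift)
  then obtain ms where "chain K (tgt K y) ms" "map cls ms = Ms"
    using Cons.IH[of "tgt K y"] Cons.prems by (auto simp: Q_tgt tgt_Obj)
  with y show ?case by (intro exI[of _ "y # ms"]) auto
qed auto

lemma lam_surj: "simplices (nerve Q) n \<subseteq> lam n ` simplices NQ n"
proof
  fix y assume y: "y \<in> simplices (nerve Q) n"
  obtain A Ms where AM: "y = (A, Ms)" "chain Q A Ms" "length Ms = n" using y by (auto simp: nerve_def)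
  then obtain a where a: "a \<in> Obj K" "A = orbit G aO a"
    using category.chain_Obj[OF category_Q] by (auto simp: Q_Obj)
  then obtain ms where ms: "chain K a ms" "map cls ms = Ms" using lift_chain AM by blast
  then have "(a, ms) \<in> simplices (nerve K) n" using AM by (auto simp: nerve_simplex)
  moreover have "nerve_map (orbit G aO) cls n (a, ms) = y" using AM a ms by (simp add: nerve_map_def)
  ultimately show "y \<in> lam n ` simplices NQ n" by (force simp: NQ_simplices lam_orbit image_iff)
qed

text \<open>The hypothesis bounds \<open>nondeg\<close> instead of the dimension \<open>n\<close>.
  It thus covers the skeleton in all dimensions for fixed \<open>t\<close>, and all simplices of a
  fixed dimension once \<open>t\<close> is large.\<close>

lemma lam_eq_imp_orbit_eq:
  assumes C: "condition_C G K aM t" "t \<ge> 2"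
    and x: "(a, ms) \<in> simplices (nerve K) n" "nondeg K ms \<le> t" and y: "y \<in> simplices (nerve K) n"
    and eq: "lam n (orbit G (act n) (a, ms)) = lam n (orbit G (act n) y)"
  shows "orbit G (act n) (a, ms) = orbit G (act n) y"
proof -
  obtain b ns where [simp]: "y = (b, ns)" by force
  have "\<exists>g \<in> carrier G. aO g a = b \<and> map (aM g) ms = ns"
    using eq x y unfolding lam_orbit[OF x(1)] lam_orbit[OF y]
    by (intro lift_chain_eq[OF C]) (auto simp: nerve_simplex nerve_map_def)
  then have "\<exists>g \<in> carrier G. act n g (a, ms) = y" by (simp add: nerve_map_def)
  then show ?thesis using orbit_act_eq_iff[OF x(1) y] by simp
qed

lemma inj_on_imp_condition_C:
  assumes "t \<ge> 2" "inj_on (lam t) (simplices NQ t)"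
  shows "condition_C G K aM t"
proof (rule condition_CI[OF assms(1)])
  fix a ms x y
  assume *: "chain K a ms" "length ms = t - 1" "x \<in> Mor K" "y \<in> Mor K"
    "src K x = vertex K a ms (length ms)" "src K y = src K x" "orbit G aM x = orbit G aM y"
  let ?x = "(a, ms @ [x])" and ?y = "(a, ms @ [y])"
  have s: "?x \<in> simplices (nerve K) t" "?y \<in> simplices (nerve K) t"
    using * assms(1) by (auto simp: nerve_simplex chain_append tgt_Obj)
  have "lam t (orbit G (act t) ?x) = lam t (orbit G (act t) ?y)"
    unfolding lam_orbit[OF s(1)] lam_orbit[OF s(2)]
    using * cls_orbit[of x y] by (simp add: nerve_map_def)
  then have "orbit G (act t) ?x = orbit G (act t) ?y"
    by (rule inj_onD[OF assms(2)]) (unfold NQ_simplices, (rule imageI s)+)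
  then obtain g where "g \<in> carrier G" "act t g ?x = ?y"
    using orbit_act_eq_iff[OF s] by blast
  \<comment> \<open>The right-hand side is written as \<open>map (\<lambda>m. m) ms\<close> so that
    \<open>map_eq_conv\<close> yields one equation per entry.\<close>
  then have "g \<in> carrier G" "map (aM g) ms = map (\<lambda>m. m) ms" "aM g x = y"
    by (auto simp: nerve_map_def)
  then show "\<exists>g \<in> carrier G. aM g x = y \<and> (\<forall>m \<in> set ms. aM g m = m)"
    unfolding map_eq_conv by blast
qed

text \<open>The simplex is pulled back along some \<alpha> from dimension \<open>k \<le> t\<close>,
  and \<open>\<alpha> n \<le> k\<close> bounds the non-identity entries independently of
  \<open>n\<close>.\<close>

lemma skel_NQ_nondeg:
  assumes "S \<in> simplices (skel t NQ) n"
  obtains a ms where "(a, ms) \<in> simplices (nerve K) n" "nondeg K ms \<le> t" "S = orbit G (act n) (a, ms)"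
proof -
  obtain k \<alpha> x where k: "k \<le> t" "\<alpha> \<in> Delta_hom n k" "x \<in> simplices (nerve K) k"
    "S = pull NQ n k \<alpha> (orbit G (act k) x)"
    using assms by (auto simp: skel_def NQ_simplices)
  obtain b ns where x: "x = (b, ns)" "chain K b ns" "length ns = k"
    using k(3) by (cases x) (auto simp: nerve_simplex)
  obtain a ms where ms: "pull (nerve K) n k \<alpha> x = (a, ms)" by force
  have "nondeg K ms \<le> \<alpha> n"
    using nondeg_nerve_pull[OF x(2), of \<alpha> n n] ms k(2) x by (auto simp: nerve_def nerve_pull_segment)
  also have "\<dots> \<le> t" using Delta_hom_le[OF k(2), of n] k(1) by simp
  finally show ?thesis
    using that[of a ms] simplicial_set.pull_simp[OF simplicial_set_nerve k(2,3)] k ms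
    by (simp add: NQ_pull)
qed

lemma simplices_skel: "simplices NQ t \<subseteq> simplices (skel t NQ) t"
proof
  fix S assume S: "S \<in> simplices NQ t"
  have "(\<lambda>i \<in> {..t}. i) \<in> Delta_hom t t" by (auto simp: Delta_hom_def mono_on_def)
  moreover have "S = pull NQ t t (\<lambda>i \<in> {..t}. i) S"
    using simplicial_set.pull_id[OF simplicial_set_NQ S] by simp
  ultimately show "S \<in> simplices (skel t NQ) t"
    unfolding skel_def using S by auto
qed

lemma condition_C_iff_injective_on_skel:
  assumes "t \<ge> 2"
  shows "condition_C G K aM t \<longleftrightarrow> injective_on_skel t NQ lam"
proof
  assume C: "condition_C G K aM t"
  show "injective_on_skel t NQ lam"
    unfolding injective_on_skel_def
  proof (intro allI inj_onI)
    fix n S T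
    assume S: "S \<in> simplices (skel t NQ) n" and T: "T \<in> simplices (skel t NQ) n"
      and eq: "lam n S = lam n T"
    obtain a ms where x: "(a, ms) \<in> simplices (nerve K) n" "nondeg K ms \<le> t"
      "S = orbit G (act n) (a, ms)"
      using skel_NQ_nondeg[OF S] by blast
    obtain b ns where y: "(b, ns) \<in> simplices (nerve K) n" "T = orbit G (act n) (b, ns)"
      using skel_NQ_nondeg[OF T] by blast
    show "S = T"
      using eq unfolding x(3) y(2) by (rule lam_eq_imp_orbit_eq[OF C assms x(1,2) y(1)])
  qed
next
  assume "injective_on_skel t NQ lam"
  then show "condition_C G K aM t"
    unfolding injective_on_skel_def
    by (intro inj_on_imp_condition_C[OF assms]) (blast intro: inj_on_subset[OF _ simplices_skel])
qed

lemma lam_iso_iff: "sset_iso NQ (nerve Q) lam \<longleftrightarrow> (\<forall>t \<ge> 2. condition_C G K aM t)"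
  unfolding sset_iso_iff_bij[OF sset_map_lam]
proof
  assume "\<forall>n. bij_betw (lam n) (simplices NQ n) (simplices (nerve Q) n)"
  then show "\<forall>t \<ge> 2. condition_C G K aM t"
    by (auto intro!: inj_on_imp_condition_C simp: bij_betw_def)
next
  assume C: "\<forall>t \<ge> 2. condition_C G K aM t"
  show "\<forall>n. bij_betw (lam n) (simplices NQ n) (simplices (nerve Q) n)"
  proof
    fix n
    have "inj_on (lam n) (simplices NQ n)"
    proof (rule inj_onI)
      fix S T assume "S \<in> simplices NQ n" "T \<in> simplices NQ n" and eq: "lam n S = lam n T"
      then obtain a ms y where x: "(a, ms) \<in> simplices (nerve K) n" "S = orbit G (act n) (a, ms)"
        and y: "y \<in> simplices (nerve K) n" "T = orbit G (act n) y"
        by (auto simp: NQ_simplices)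
      \<comment> \<open>The index \<open>n + 2\<close> is at least the chain length \<open>n\<close>
        and also at least 2, so low dimensions need no separate treatment.\<close>
      have "nondeg K ms \<le> n + 2"
        using nondeg_le_length[of K ms] x(1) by (simp add: nerve_simplex)
      then show "S = T"
        using lam_eq_imp_orbit_eq[of "n + 2" a ms n y] C x y eq by simp
    qed
    moreover have "lam n ` simplices NQ n \<subseteq> simplices (nerve Q) n"
      using sset_map.map_simp[OF sset_map_lam] by blast
    ultimately show "bij_betw (lam n) (simplices NQ n) (simplices (nerve Q) n)"
      using lam_surj[of n] by (simp add: bij_betw_def subset_antisym)
  qed
qed

end

theorem theorem5p3p4:
  fixes G :: "('g, 'z) monoid_scheme" and K :: "('o, 'm) cat_data"
    and aO :: "'g \<Rightarrow> 'o \<Rightarrow> 'o" and aM :: "'g \<Rightarrow> 'm \<Rightarrow> 'm"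
  assumes "cat_action G K aO aM"
  shows "(\<forall>t \<ge> 2. condition_C G K aM t
            \<longleftrightarrow> injective_on_skel t (nerve_quot G K aO aM) (canonical_map G K aO aM))
       \<and> (sset_iso (nerve_quot G K aO aM) (nerve (quot_cat G K aO aM)) (canonical_map G K aO aM)
            \<longleftrightarrow> (\<forall>t \<ge> 2. condition_C G K aM t))"
  using cat_action.condition_C_iff_injective_on_skel[OF assms] cat_action.lam_iso_iff[OF assms]
  by blast

end
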